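(* Let $E$ be an infinite-dimensional separable real Hilbert space and let $\mathcal E=\{e_i\}$, $\mathcal F=\{f_j\}$ be orthonormal bases of $E$ for which the condition $\prod_{j=1}^\infty\bigl(\sum_{i=1}^\infty|(e_i,f_j)|\bigr)<+\infty$ is not satisfied. Then for any set $A\in\mathcal R_{\mathcal E}\cap\mathcal R_{\mathcal F}$ the equalities $\lambda_{\mathcal F}(A)=0$ and $\lambda_{\mathcal E}(A)=0$ hold.
   Context: For an orthonormal basis $\mathcal E=\{e_j\}_{j\in\mathbb N}$ of $E$, $\mathcal K_{\mathcal E}$ denotes the collection consisting of $\varnothing$ and of all nonempty sets $\Pi=\{x\in E:\ (x,e_j)\in[a_j,b_j)\ \forall j\in\mathbb N\}$ with $a,b\in\ell_\infty$ and $\sum_{j=1}^\infty\max\{0,\ln(b_j-a_j)\}<\infty$ (measurable rectangles). Put $\lambda_{\mathcal E}(\varnothing)=0$ and $\lambda_{\mathcal E}(\Pi)=\exp\bigl[\sum_{j=1}^\infty\ln(b_j-a_j)\bigr]\in[0,+\infty)$ (equal to $0$ if the sum is $-\infty$). It is known that $\lambda_{\mathcal E}$ extends uniquely to a finitely additive shift-invariant measure on the ring $r_{\mathcal E}$ (closed under finite unions and differences) generated by $\mathcal K_{\mathcal E}$. $\mathcal R_{\mathcal E}$ is the ring of all $A\subset E$ such that for every $\epsilon>0$ there are $A_*,A^*\in r_{\mathcal E}$ with $A_*\subset A\subset A^*$ and $\lambda_{\mathcal E}(A^*\setminus A_* )<\epsilon$, and $\lambda_{\mathcal E}(A)=\inf\{\lambda_{\mathcal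 E}(A^* ):A^*\in r_{\mathcal E},A^*\supset A\}$ for $A\in\mathcal R_{\mathcal E}$. The factors $\sum_i|(e_i,f_j)|$ lie in $[1,+\infty]$, so the product is always defined in $[1,+\infty]$. *)

theory Defs
  imports "HOL-Analysis.Analysis"
begin

definition orthonormal_basis :: "(nat \<Rightarrow> 'a::real_inner) \<Rightarrow> bool" where
  "orthonormal_basis e \<longleftrightarrow>
     (\<forall>i j. e i \<bullet> e j = (if i = j then 1 else 0)) \<and> closure (span (range e)) = UNIV"

definition rectangle :: "(nat \<Rightarrow> 'a::real_inner) \<Rightarrow> (nat \<Rightarrow> real) \<Rightarrow> (nat \<Rightarrow> real) \<Rightarrow> 'a set" where
  "rectangle e a b = {x. \<forall>j. x \<bullet> e j \<in> {a j..<b j}}"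

text \<open>Nonemptiness forces \<open>a j < b j\<close> for all \<open>j\<close>, so the logarithms below are
  logarithms of positive numbers; it also makes \<open>a\<close> and \<open>b\<close> uniquely
  determined by the rectangle when \<open>e\<close> is an orthonormal basis.\<close>

definition measurable_rectangle ::
    "(nat \<Rightarrow> 'a::real_inner) \<Rightarrow> (nat \<Rightarrow> real) \<Rightarrow> (nat \<Rightarrow> real) \<Rightarrow> bool" where
  "measurable_rectangle e a b \<longleftrightarrow>
     rectangle e a b \<noteq> {} \<and> bounded (range a) \<and> bounded (range b) \<and>
     summable (\<lambda>j. max 0 (ln (b j - a j)))"

definition rectangles :: "(nat \<Rightarrow> 'a::real_inner) \<Rightarrow> 'a set set" where
  "rectangles e = insert {} {rectangle e a b | a b. measurable_rectangle e a b}"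

text \<open>Since the positive parts are summable, the series of logarithms either converges
  or has sum \<open>-\<infinity>\<close>; the latter is the \<open>else\<close> case.\<close>

definition rectangle_vol :: "(nat \<Rightarrow> real) \<Rightarrow> (nat \<Rightarrow> real) \<Rightarrow> real" where
  "rectangle_vol a b =
     (if summable (\<lambda>j. ln (b j - a j)) then exp (\<Sum>j. ln (b j - a j)) else 0)"

definition rect_ring :: "(nat \<Rightarrow> 'a::real_inner) \<Rightarrow> 'a set set" where
  "rect_ring e = \<Inter>{R. ring_of_sets UNIV R \<and> rectangles e \<subseteq> R}"

definition is_rect_measure :: "(nat \<Rightarrow> 'a::real_inner) \<Rightarrow> ('a set \<Rightarrow> real) \<Rightarrow> bool" where
  "is_rect_measure e \<mu> \<longleftrightarrow>
     \<mu> {} = 0 \<and>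
     (\<forall>a b. measurable_rectangle e a b \<longrightarrow> \<mu> (rectangle e a b) = rectangle_vol a b) \<and>
     (\<forall>A\<in>rect_ring e. 0 \<le> \<mu> A) \<and>
     (\<forall>A\<in>rect_ring e. \<forall>B\<in>rect_ring e. A \<inter> B = {} \<longrightarrow> \<mu> (A \<union> B) = \<mu> A + \<mu> B) \<and>
     (\<forall>A\<in>rect_ring e. \<forall>h. (+) h ` A \<in> rect_ring e \<and> \<mu> ((+) h ` A) = \<mu> A)"

text \<open>For an orthonormal basis \<open>e\<close> such a set function exists and is unique on
  \<open>rect_ring e\<close>; the choice affects only its irrelevant values outside the ring.\<close>

definition rect_measure :: "(nat \<Rightarrow> 'a::real_inner) \<Rightarrow> 'a set \<Rightarrow> real" where
  "rect_measure e = (SOME \<mu>. is_rect_measure e \<mu>)"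

definition completed_ring :: "(nat \<Rightarrow> 'a::real_inner) \<Rightarrow> 'a set set" where
  "completed_ring e =
     {A. \<forall>\<epsilon>>0. \<exists>L\<in>rect_ring e. \<exists>U\<in>rect_ring e.
           L \<subseteq> A \<and> A \<subseteq> U \<and> rect_measure e (U - L) < \<epsilon>}"

definition completed_measure :: "(nat \<Rightarrow> 'a::real_inner) \<Rightarrow> 'a set \<Rightarrow> real" where
  "completed_measure e A = Inf (rect_measure e ` {U \<in> rect_ring e. A \<subseteq> U})"

end

theory Submission
  imports Defs "HOL-Probability.Infinite_Product_Measure"
begin

text \<open>
  A set of \<open>completed_ring f\<close> of nonzero measure contains an \<open>f\<close>-rectangle \<open>Q\<close> of positive volume; if
  it also lies in \<open>completed_ring e\<close>, finitely many \<open>e\<close>-rectangles cover \<open>Q\<close>. Shrinking \<open>Q\<close> so that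
  it avoids as many of them as possible, one may assume that in every direction \<open>e i\<close> the width
  \<open>\<Sum>j. \<bar>e i \<bullet> f j\<bar> d j\<close> of \<open>Q\<close>, where \<open>d\<close> are its side lengths, is at most that of a single one of
  them. Since \<open>\<Sum>j. \<bar>1 - (d j)\<^sup>2\<bar>\<close> converges and the rows of \<open>e i \<bullet> f j\<close> have norm one, comparing the
  \<open>\<ell>\<^sub>1\<close> and \<open>\<ell>\<^sub>2\<close> norms of the rows shows that all but one entry of each row sum up, over all rows, to
  something finite. Then the products of the row sums and of the column sums are both finite.

  The argument needs that the rectangle measure exists. This reduces to: if a linear combination of
  indicators of rectangles is nonnegative, so is the combination of their volumes. On the
  subrectangles of one rectangle this follows by integrating against a product of uniform
  distributions.
\<close>

subsection \<open>Orthonormal bases\<close>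

text \<open>The product measure lives on all real sequences, where the square summable ones may form
  a null set. Positivity transfers nevertheless, because finitely many rectangles cannot tell a
  given sequence from the coordinates of some point of the space. For the row
  \<open>c j = e i \<bullet> f j\<close>, the weighted row
  \<open>v j = \<bar>c j\<bar> * d j\<close> has as l1 norm \<open>w\<close> the width in direction
  \<open>e i\<close>. This is at most a side of an \<open>e\<close>-rectangle, so the positive parts
  of w^2 - 1 are summable over the rows. The squared l2 norm \<open>s\<close> of \<open>v\<close>
  falls short of 1 by at most the sum of c^2 |1 - d^2| over \<open>j\<close>; summing over the rows
  costs only the sum of |1 - d^2|, as the columns are unit vectors. Some entry satisfies
  \<open>s \<le> v k * w\<close>, so w (w - v k) is at most (w^2 - 1) + (1 - s), which bounds the
  rest of the row. The hypothesis concerns the column sums of \<open>e i \<bullet> f j\<close>,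
  whereas a nonzero measure for \<open>f\<close> controls its rows. Passing to columns requires that
  the distinguished entries of distinct rows eventually lie in distinct columns.\<close>

lemma onb_inner:
  "orthonormal_basis e \<Longrightarrow> e i \<bullet> e j = (if i = j then 1 else 0)"
  by (simp add: orthonormal_basis_def)

lemma onb_norm [simp]: "orthonormal_basis e \<Longrightarrow> norm (e i) = 1"
  by (simp add: norm_eq_sqrt_inner onb_inner)

lemma onb_inner_sum:
  assumes "orthonormal_basis e" "finite J"
  shows "(\<Sum>j\<in>J. t j *\<^sub>R e j) \<bullet> e i = (if i \<in> J then t i else 0)"
proof -
  have "(\<Sum>j\<in>J. t j *\<^sub>R e j) \<bullet> e i = (\<Sum>j\<in>J. if i = j then t j else 0)"
    unfolding inner_sum_left using onb_inner[OF assms(1)] by (intro sum.cong) auto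
  then show ?thesis using assms by simp
qed

lemma onb_norm_sum:
  assumes "orthonormal_basis e" "finite J"
  shows "(norm (\<Sum>j\<in>J. t j *\<^sub>R e j))\<^sup>2 = (\<Sum>j\<in>J. (t j)\<^sup>2)"
  unfolding power2_norm_eq_inner inner_sum_right
  using assms by (auto simp: onb_inner_sum power2_eq_square intro!: sum.cong)

lemma onb_best_approx:
  assumes "orthonormal_basis e" "finite J"
  shows "norm (x - (\<Sum>j\<in>J. (x \<bullet> e j) *\<^sub>R e j)) \<le> norm (x - (\<Sum>j\<in>J. t j *\<^sub>R e j))"
proof -
  let ?p = "\<Sum>j\<in>J. (x \<bullet> e j) *\<^sub>R e j" and ?s = "\<Sum>j\<in>J. t j *\<^sub>R e j"
  have ortho: "(x - ?p) \<bullet> e j = 0" if "j \<in> J" for j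
    using onb_inner_sum[OF assms, of "\<lambda>j. x \<bullet> e j" j] that by (simp add: inner_diff_left)
  have "?p - ?s = (\<Sum>j\<in>J. (x \<bullet> e j - t j) *\<^sub>R e j)"
    by (simp add: sum_subtractf scaleR_diff_left)
  then have "(x - ?p) \<bullet> (?p - ?s) = 0"
    using ortho by (simp add: inner_sum_right)
  then have "(norm (x - ?s))\<^sup>2 = (norm (x - ?p))\<^sup>2 + (norm (?p - ?s))\<^sup>2"
    using norm_add_Pythagorean[of "x - ?p" "?p - ?s"]
    by (simp add: orthogonal_def)
  then have "(norm (x - ?p))\<^sup>2 \<le> (norm (x - ?s))\<^sup>2" by simp
  then show ?thesis by (rule power2_le_imp_le) simp
qed

text \<open>Density of the span supplies some finite combination near \<open>x\<close>; by best
  approximation, the Fourier sum over any initial segment containing its indices is at least as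
  near.\<close>

lemma onb_expansion:
  assumes "orthonormal_basis e"
  shows "(\<lambda>j. (x \<bullet> e j) *\<^sub>R e j) sums x"
  unfolding sums_def
proof (rule metric_LIMSEQ_I)
  fix r :: real assume "r > 0"
  have "x \<in> closure (span (range e))"
    using assms by (simp add: orthonormal_basis_def)
  then obtain y where y: "y \<in> span (range e)" "dist y x < r"
    using \<open>r > 0\<close> by (auto simp: closure_approachable)
  from y(1) obtain S c where S: "finite S" "S \<subseteq> range e" and yS: "y = (\<Sum>a\<in>S. c a *\<^sub>R a)"
    by (auto simp: span_explicit)
  have inj: "inj e"
  proof (rule injI)
    fix i j assume "e i = e j"
    then have "e i \<bullet> e j = 1" using onb_inner[OF assms, of i i] by simp
    then show "i = j" using onb_inner[OF assms, of i j] by (auto split: if_splits)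
  qed
  from finite_subset_image[OF S] obtain J where J: "finite J" "S = e ` J" by auto
  have y': "y = (\<Sum>j\<in>J. c (e j) *\<^sub>R e j)"
    unfolding yS J(2) using inj by (subst sum.reindex) (auto intro: inj_on_subset)
  obtain n0 where n0: "J \<subseteq> {..<n0}"
    using finite_nat_iff_bounded J(1) by auto
  have "dist (\<Sum>j<n. (x \<bullet> e j) *\<^sub>R e j) x < r" if "n \<ge> n0" for n
  proof -
    have sub: "J \<subseteq> {..<n}" using n0 that by auto
    have "y = (\<Sum>j<n. (if j \<in> J then c (e j) else 0) *\<^sub>R e j)"
      unfolding y' using sub by (intro sum.mono_neutral_cong_left) auto
    then have "norm (x - (\<Sum>j<n. (x \<bullet> e j) *\<^sub>R e j)) \<le> norm (x - y)"
      using onb_best_approx[OF assms, of "{..<n}" x] by simp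
    then show ?thesis using y(2) by (simp add: dist_norm norm_minus_commute)
  qed
  then show "\<exists>no. \<forall>n\<ge>no. dist (\<Sum>j<n. (x \<bullet> e j) *\<^sub>R e j) x < r" by blast
qed

lemma onb_inner_sums:
  assumes "orthonormal_basis e"
  shows "(\<lambda>j. (x \<bullet> e j) * (e j \<bullet> y)) sums (x \<bullet> y)"
  using bounded_linear.sums[OF bounded_linear_inner_left onb_expansion[OF assms], of x y]
  by simp

lemma onb_parseval:
  assumes "orthonormal_basis e"
  shows "(\<lambda>j. (x \<bullet> e j)\<^sup>2) sums (norm x)\<^sup>2"
  using onb_inner_sums[OF assms, of x x]
  by (simp add: power2_norm_eq_inner inner_commute power2_eq_square[of "x \<bullet> _"])

text \<open>Completeness of the space enters through this lemma: it lets a point be prescribed by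
  its coordinates.\<close>

lemma riesz_fischer:
  fixes e :: "nat \<Rightarrow> 'a::{real_inner, complete_space}"
  assumes e: "orthonormal_basis e" and t: "summable (\<lambda>j. (t j)\<^sup>2)"
  shows "\<exists>x. \<forall>j. x \<bullet> e j = t j"
proof -
  let ?s = "\<lambda>n. \<Sum>j<n. t j *\<^sub>R e j"
  have "Cauchy ?s"
  proof (rule metric_CauchyI)
    fix r :: real assume "r > 0"
    then have "r\<^sup>2 > 0" by simp
    then obtain N where N: "\<And>m n. m \<ge> N \<Longrightarrow> norm (\<Sum>j\<in>{m..<n}. (t j)\<^sup>2) < r\<^sup>2"
      using t unfolding summable_Cauchy by blast
    have *: "dist (?s n) (?s m) < r" if "N \<le> m" "m \<le> n" for m n
    proof -
      have "?s n - ?s m = (\<Sum>j\<in>{m..<n}. t j *\<^sub>R e j)"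
        using that by (subst sum_diff[symmetric]) (auto intro!: sum.cong)
      then have "(dist (?s n) (?s m))\<^sup>2 = (\<Sum>j\<in>{m..<n}. (t j)\<^sup>2)"
        using onb_norm_sum[OF e, of "{m..<n}" t] by (simp add: dist_norm)
      then have "(dist (?s n) (?s m))\<^sup>2 < r\<^sup>2"
        using N[OF that(1), of n] by simp
      then show ?thesis using \<open>r > 0\<close> by (simp add: power2_less_imp_less)
    qed
    show "\<exists>M. \<forall>m\<ge>M. \<forall>n\<ge>M. dist (?s m) (?s n) < r"
      by (metis * dist_commute nle_le)
  qed
  then obtain x where x: "?s \<longlonglongrightarrow> x"
    using Cauchy_convergent_iff convergent_def by blast
  have "x \<bullet> e j = t j" for j
  proof (rule LIMSEQ_unique)
    show "(\<lambda>n. ?s n \<bullet> e j) \<longlonglongrightarrow> x \<bullet> e j" by (intro tendsto_intros x)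
    have "eventually (\<lambda>n. ?s n \<bullet> e j = t j) sequentially"
      using eventually_gt_at_top[of j] by eventually_elim (simp add: onb_inner_sum[OF e])
    then show "(\<lambda>n. ?s n \<bullet> e j) \<longlonglongrightarrow> t j" by (rule tendsto_eventually)
  qed
  then show ?thesis by blast
qed

subsection \<open>Volumes of sequence boxes\<close>

type_synonym seq_bounds = "(nat \<Rightarrow> real) \<times> (nat \<Rightarrow> real)"

text \<open>The counterpart of \<open>rectangle\<close> among all real sequences, including those
  that are no coordinate sequence. The bounds are unconstrained, so that intersections keep this
  format even when empty.\<close>

definition seq_box :: "seq_bounds \<Rightarrow> (nat \<Rightarrow> real) set" where
  "seq_box p = {t. \<forall>j. fst p j \<le> t j \<and> t j < snd p j}"

definition box_inter :: "seq_bounds \<Rightarrow> seq_bounds \<Rightarrow> seq_bounds" where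
  "box_inter p q = (\<lambda>j. max (fst p j) (fst q j), \<lambda>j. min (snd p j) (snd q j))"

text \<open>Truncating the sides at 0 makes boxes with reversed bounds null. \<open>lim\<close> is
  unspecified for divergent products, which is what \<open>finite_vol\<close> excludes.\<close>

definition box_vol :: "seq_bounds \<Rightarrow> real" where
  "box_vol p = lim (\<lambda>n. \<Prod>j<n. max 0 (snd p j - fst p j))"

definition finite_vol :: "seq_bounds \<Rightarrow> bool" where
  "finite_vol p \<longleftrightarrow> convergent (\<lambda>n. \<Prod>j<n. max 0 (snd p j - fst p j))"

lemma seq_box_inter: "seq_box (box_inter p q) = seq_box p \<inter> seq_box q"
  by (auto simp: seq_box_def box_inter_def)

lemma box_inter_self [simp]: "box_inter p p = p"
  by (simp add: box_inter_def)

lemma box_inter_right_commute: "box_inter (box_inter q p) r = box_inter (box_inter q r) p"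
  by (auto simp: box_inter_def max.assoc max.commute max.left_commute min.assoc min.commute min.left_commute)

lemma seq_box_measurable: "seq_box q \<in> sets (Pi\<^sub>M UNIV (\<lambda>_. borel))"
proof -
  have "seq_box q = {t \<in> space (Pi\<^sub>M UNIV (\<lambda>_. borel)). \<forall>j. fst q j \<le> t j \<and> t j < snd q j}"
    by (auto simp: seq_box_def space_PiM)
  also have "\<dots> \<in> sets (Pi\<^sub>M UNIV (\<lambda>_. borel))"
    by measurable
  finally show ?thesis .
qed

text \<open>Continuity from above: the box is the intersection of the decreasing cylinders over its
  first sides, whose measures are the finite products.\<close>

lemma PiM_seq_box:
  fixes N :: "nat \<Rightarrow> real measure"
  assumes N: "\<And>j. prob_space (N j)" and sets: "\<And>j. sets (N j) = sets borel"
  shows "(\<lambda>n. \<Prod>j<n. measure (N j) {fst q j..<snd q j}) \<longlonglongrightarrow> measure (Pi\<^sub>M UNIV N) (seq_box q)"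
proof -
  interpret prob_space "N j" for j by (rule N)
  interpret product_prob_space N UNIV ..
  define X where "X n = prod_emb UNIV N {..n} (Pi\<^sub>E {..n} (\<lambda>j. {fst q j..<snd q j}))" for n
  have space: "space (N j) = UNIV" for j
    using sets_eq_imp_space_eq[OF sets] by simp
  have "(\<Prod>j\<le>n. measure (N j) {fst q j..<snd q j}) = measure (Pi\<^sub>M UNIV N) (X n)" for n
    unfolding X_def by (rule measure_PiM_emb[symmetric]) (auto simp: sets)
  moreover have "seq_box q = (\<Inter>n. X n)"
    by (fastforce simp: X_def seq_box_def prod_emb_def space Pi_iff)
  moreover have "range X \<subseteq> sets (Pi\<^sub>M UNIV N)"
    by (auto simp: X_def sets intro!: sets_PiM_I)
  moreover have "decseq X"
    by (auto simp: X_def prod_emb_def Pi_iff decseq_def)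
  ultimately have "(\<lambda>n. \<Prod>j\<le>n. measure (N j) {fst q j..<snd q j}) \<longlonglongrightarrow> measure (Pi\<^sub>M UNIV N) (seq_box q)"
    by (simp add: finite_Lim_measure_decseq)
  then show ?thesis by (simp add: LIMSEQ_lessThan_iff_atMost)
qed

text \<open>Dividing the sides of a subbox by those of \<open>p\<close> turns volumes into
  probabilities of a product of uniform distributions. If \<open>p\<close> is null, so is every
  subbox, and the zero measure serves.\<close>

lemma box_vol_eq_measure:
  assumes "finite_vol p"
  obtains M where "finite_measure M" "\<And>q. seq_box q \<in> sets M"
    "\<And>q. box_vol (box_inter q p) = box_vol p * measure M (seq_box q \<inter> seq_box p)"
proof -
  let ?d = "\<lambda>j. max 0 (snd p j - fst p j)"
  have lim: "(\<lambda>n. \<Prod>j<n. ?d j) \<longlonglongrightarrow> box_vol p"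
    using assms by (simp add: finite_vol_def box_vol_def convergent_LIMSEQ_iff)
  have nonneg: "box_vol p \<ge> 0"
    by (rule LIMSEQ_le_const[OF lim]) (auto intro!: prod_nonneg)
  show thesis
  proof (cases "box_vol p = 0")
    case True
    have "box_vol (box_inter q p) = 0" for q
      unfolding box_vol_def[of "box_inter q p"]
    proof (rule limI, rule tendsto_sandwich[OF _ _ tendsto_const])
      show "(\<lambda>n. \<Prod>j<n. ?d j) \<longlonglongrightarrow> 0" using lim True by simp
      show "eventually (\<lambda>n. 0 \<le> (\<Prod>j<n. max 0 (snd (box_inter q p) j - fst (box_inter q p) j))) sequentially"
        by (auto intro!: always_eventually prod_nonneg)
      show "eventually (\<lambda>n. (\<Prod>j<n. max 0 (snd (box_inter q p) j - fst (box_inter q p) j))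
              \<le> (\<Prod>j<n. ?d j)) sequentially"
        by (auto intro!: always_eventually prod_mono simp: box_inter_def)
    qed
    moreover have "finite_measure (null_measure (Pi\<^sub>M UNIV (\<lambda>_. borel :: real measure)))"
      by (rule finite_measureI) simp
    ultimately show thesis
      by (intro that[of "null_measure (Pi\<^sub>M UNIV (\<lambda>_. borel))"])
        (auto simp: seq_box_measurable True)
  next
    case False
    then have pos: "box_vol p > 0" using nonneg by simp
    have d: "fst p j < snd p j" for j
    proof (rule ccontr)
      assume j: "\<not> fst p j < snd p j"
      have "eventually (\<lambda>n. (\<Prod>j<n. ?d j) = 0) sequentially"
        using eventually_gt_at_top[of j]
        by eventually_elim (use j in \<open>auto simp: prod_zero_iff intro!: bexI[of _ j]\<close>)
      then have "(\<lambda>n. \<Prod>j<n. ?d j) \<longlonglongrightarrow> 0" by (rule tendsto_eventually)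
      with lim False show False using LIMSEQ_unique by blast
    qed
    define N where "N j = uniform_measure lborel {fst p j..<snd p j}" for j
    have em: "emeasure lborel {fst p j..<snd p j} = ennreal (snd p j - fst p j)" for j
      using d[of j] by simp
    have prob: "prob_space (N j)" for j
      unfolding N_def by (rule prob_space_uniform_measure) (use d[of j] in \<open>auto simp: em\<close>)
    interpret prob_space "N j" for j by (rule prob)
    interpret product_prob_space N UNIV ..
    have sets: "sets (N j) = sets borel" for j by (simp add: N_def)
    have setsP: "sets (Pi\<^sub>M UNIV N) = sets (Pi\<^sub>M UNIV (\<lambda>_. borel))"
      by (rule sets_PiM_cong) (auto simp: sets)
    have meas: "measure (N j) {fst (box_inter q p) j..<snd (box_inter q p) j}
        = max 0 (snd (box_inter q p) j - fst (box_inter q p) j) / ?d j" for q j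
    proof -
      have "{fst p j..<snd p j} \<inter> {fst (box_inter q p) j..<snd (box_inter q p) j}
          = {fst (box_inter q p) j..<snd (box_inter q p) j}"
        by (auto simp: box_inter_def)
      then show ?thesis
        unfolding N_def using d[of j]
        by (subst measure_uniform_measure) (auto simp: em max_def)
    qed
    have "box_vol (box_inter q p) = box_vol p * measure (Pi\<^sub>M UNIV N) (seq_box q \<inter> seq_box p)" for q
    proof -
      have "(\<lambda>n. (\<Prod>j<n. ?d j) * (\<Prod>j<n. measure (N j) {fst (box_inter q p) j..<snd (box_inter q p) j}))
          \<longlonglongrightarrow> box_vol p * measure (Pi\<^sub>M UNIV N) (seq_box (box_inter q p))"
        by (intro tendsto_mult lim PiM_seq_box prob sets)
      moreover have "(\<Prod>j<n. ?d j) * (\<Prod>j<n. measure (N j) {fst (box_inter q p) j..<snd (box_inter q p) j})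
          = (\<Prod>j<n. max 0 (snd (box_inter q p) j - fst (box_inter q p) j))" for n
      proof -
        have "?d j \<noteq> 0" for j using d[of j] by simp
        then show ?thesis by (simp add: meas prod.distrib[symmetric])
      qed
      ultimately show ?thesis
        unfolding box_vol_def[of "box_inter q p"] by (simp add: limI seq_box_inter)
    qed
    then show thesis
      by (intro that[of "Pi\<^sub>M UNIV N"]) (auto simp: setsP seq_box_measurable intro: P.finite_measure_axioms)
  qed
qed

text \<open>\<open>vol_out X p\<close> is the volume of the part of \<open>p\<close> outside the boxes of \<open>X\<close>, written by
  inclusion-exclusion so that it makes sense before any measure has been constructed.\<close>

primrec vol_out :: "seq_bounds list \<Rightarrow> seq_bounds \<Rightarrow> real" where
  "vol_out [] = box_vol"
| "vol_out (r # X) = (\<lambda>p. vol_out X p - vol_out X (box_inter p r))"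

text \<open>Each step of the recursion removes one more box, as the measure of a difference. The
  intersection with \<open>p\<close> is kept throughout because \<open>M\<close> describes volumes
  only inside \<open>p\<close>.\<close>

lemma vol_out_eq_measure:
  assumes "finite_measure M" and sets: "\<And>q. seq_box q \<in> sets M"
    and vol: "\<And>q. box_vol (box_inter q p) = v * measure M (seq_box q \<inter> seq_box p)"
  shows "vol_out X (box_inter q p) = v * measure M (seq_box q \<inter> (seq_box p - \<Union>(seq_box ` set X)))"
proof (induction X arbitrary: q)
  case Nil
  then show ?case by (simp add: vol)
next
  case (Cons r X)
  interpret finite_measure M by fact
  let ?U = "\<Union>(seq_box ` set X)"
  have U: "?U \<in> sets M" by (auto simp: sets)
  have "measure M (seq_box q \<inter> (seq_box p - ?U) - seq_box (box_inter q r) \<inter> (seq_box p - ?U))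
      = measure M (seq_box q \<inter> (seq_box p - ?U)) - measure M (seq_box (box_inter q r) \<inter> (seq_box p - ?U))"
    using U sets by (intro finite_measure_Diff) (auto simp: seq_box_inter)
  moreover have "seq_box q \<inter> (seq_box p - ?U) - seq_box (box_inter q r) \<inter> (seq_box p - ?U)
      = seq_box q \<inter> (seq_box p - \<Union>(seq_box ` set (r # X)))"
    by (auto simp: seq_box_inter)
  ultimately show ?case
    by (simp add: box_inter_right_commute[of q p r] Cons.IH right_diff_distrib)
qed

text \<open>The combination of measures is the integral of the pointwise nonnegative combination of
  indicators.\<close>

lemma sum_list_measure_nonneg:
  assumes "finite_measure M" and sets: "\<And>c p. (c, p) \<in> set L \<Longrightarrow> A p \<in> sets M"
    and nonneg: "\<And>t. (\<Sum>(c, p)\<leftarrow>L. c * indicator (A p) t) \<ge> (0::real)"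
  shows "(\<Sum>(c, p)\<leftarrow>L. c * measure M (A p)) \<ge> 0"
proof -
  interpret finite_measure M by fact
  have "integrable M (\<lambda>t. \<Sum>(c, p)\<leftarrow>L. c * indicator (A p) t) \<and>
      (\<integral>t. (\<Sum>(c, p)\<leftarrow>L. c * indicator (A p) t) \<partial>M) = (\<Sum>(c, p)\<leftarrow>L. c * measure M (A p))"
    using sets
  proof (induction L)
    case (Cons cp L)
    obtain c p where "cp = (c, p)" by (cases cp)
    moreover have "A p \<in> sets M" using Cons.prems[of c p] calculation by simp
    moreover from this have "integrable M (indicator (A p) :: _ \<Rightarrow> real)"
      by (auto simp: integrable_indicator_iff less_top[symmetric])
    moreover have "integrable M (\<lambda>t. \<Sum>(c, p)\<leftarrow>L. c * indicator (A p) t) \<and>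
        (\<integral>t. (\<Sum>(c, p)\<leftarrow>L. c * indicator (A p) t) \<partial>M) = (\<Sum>(c, p)\<leftarrow>L. c * measure M (A p))"
      using Cons.prems by (intro Cons.IH) auto
    ultimately show ?case by (auto simp: Bochner_Integration.integral_add)
  qed simp
  then show ?thesis
    using Bochner_Integration.integral_nonneg[of M "\<lambda>t. \<Sum>(c, p)\<leftarrow>L. c * indicator (A p) t"] nonneg
    by metis
qed

text \<open>The induction moves the first box \<open>\<pi>\<close> of \<open>L\<close> to \<open>X\<close>. The part of the sum inside \<open>\<pi>\<close> is
  an integral against the uniform product probability on \<open>\<pi>\<close>; outside \<open>\<pi>\<close> the first summand
  vanishes.\<close>

lemma vol_out_nonneg:
  assumes "\<And>c p. (c, p) \<in> set L \<Longrightarrow> finite_vol p"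
    and "\<And>t. t \<notin> \<Union>(seq_box ` set X) \<Longrightarrow> (\<Sum>(c, p)\<leftarrow>L. c * indicator (seq_box p) t) \<ge> (0::real)"
  shows "(\<Sum>(c, p)\<leftarrow>L. c * vol_out X p) \<ge> 0"
  using assms
proof (induction L arbitrary: X)
  case Nil
  then show ?case by simp
next
  case (Cons c\<pi> L)
  obtain c0 \<pi> where \<pi>: "c\<pi> = (c0, \<pi>)" by (cases c\<pi>)
  let ?L = "c\<pi> # L" and ?D = "seq_box \<pi> - \<Union>(seq_box ` set X)"
  have "finite_vol \<pi>" using Cons.prems(1)[of c0 \<pi>] \<pi> by simp
  from box_vol_eq_measure[OF this] obtain M where M: "finite_measure M" "\<And>q. seq_box q \<in> sets M"
    "\<And>q. box_vol (box_inter q \<pi>) = box_vol \<pi> * measure M (seq_box q \<inter> seq_box \<pi>)"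
    by metis
  have v0: "box_vol \<pi> \<ge> 0"
    using \<open>finite_vol \<pi>\<close> unfolding finite_vol_def box_vol_def convergent_LIMSEQ_iff
    by (rule LIMSEQ_le_const) (auto intro!: prod_nonneg)
  have "(\<Sum>(c, p)\<leftarrow>?L. c * measure M (seq_box p \<inter> ?D)) \<ge> 0"
  proof (rule sum_list_measure_nonneg[OF M(1)])
    fix t
    have "(\<Sum>(c, p)\<leftarrow>?L. c * indicator (seq_box p \<inter> ?D) t)
        = indicator ?D t * (\<Sum>(c, p)\<leftarrow>?L. c * indicator (seq_box p) t :: real)"
      unfolding sum_list_const_mult[symmetric]
      by (rule arg_cong[of _ _ sum_list], rule map_cong) (auto simp: indicator_def)
    also have "\<dots> \<ge> 0"
      using Cons.prems(2)[of t] by (auto simp: indicator_def)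
    finally show "(\<Sum>(c, p)\<leftarrow>?L. c * indicator (seq_box p \<inter> ?D) t) \<ge> (0::real)" .
  next
    show "seq_box p \<inter> ?D \<in> sets M" for p
      by (intro sets.Int sets.Diff sets.finite_UN M(2)) simp
  qed
  moreover have "(\<Sum>(c, p)\<leftarrow>?L. c * vol_out X (box_inter p \<pi>))
      = box_vol \<pi> * (\<Sum>(c, p)\<leftarrow>?L. c * measure M (seq_box p \<inter> ?D))"
    unfolding sum_list_const_mult[symmetric]
    by (rule arg_cong[of _ _ sum_list], rule map_cong)
      (auto simp: vol_out_eq_measure[OF M])
  ultimately have inside: "(\<Sum>(c, p)\<leftarrow>?L. c * vol_out X (box_inter p \<pi>)) \<ge> 0"
    using v0 by (simp add: zero_le_mult_iff)
  have outside: "(\<Sum>(c, p)\<leftarrow>L. c * vol_out (\<pi> # X) p) \<ge> 0"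
  proof (rule Cons.IH)
    fix t assume "t \<notin> \<Union>(seq_box ` set (\<pi> # X))"
    then show "(\<Sum>(c, p)\<leftarrow>L. c * indicator (seq_box p) t) \<ge> (0::real)"
      using Cons.prems(2)[of t] by (simp add: \<pi>)
  qed (use Cons.prems(1) in auto)
  have "(\<Sum>(c, p)\<leftarrow>?L. c * vol_out X p) = (\<Sum>(c, p)\<leftarrow>?L. c * vol_out X (box_inter p \<pi>))
      + (\<Sum>(c, p)\<leftarrow>?L. c * vol_out (\<pi> # X) p)"
    unfolding sum_list_addf[symmetric]
    by (rule arg_cong[of _ _ sum_list], rule map_cong) (auto simp: algebra_simps)
  \<comment> \<open>The head term drops out: \<open>box_inter \<pi> \<pi> = \<pi>\<close>, so
    \<open>vol_out (\<pi> # X) \<pi>\<close> is a difference of equal terms.\<close>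
  also have "(\<Sum>(c, p)\<leftarrow>?L. c * vol_out (\<pi> # X) p) = (\<Sum>(c, p)\<leftarrow>L. c * vol_out (\<pi> # X) p)"
    by (simp add: \<pi>)
  finally show ?case using inside outside by simp
qed

subsection \<open>Existence of the rectangle measure\<close>

lemma rectangle_box_inter:
  "rectangle e (fst (box_inter p q)) (snd (box_inter p q))
    = rectangle e (fst p) (snd p) \<inter> rectangle e (fst q) (snd q)"
  by (auto simp: rectangle_def box_inter_def)

lemma rectangle_nonempty_less: "rectangle e a b \<noteq> {} \<Longrightarrow> a j < b j"
  unfolding rectangle_def by (auto dest!: spec[of _ j] intro: le_less_trans)

lemma measurable_rectangle_less: "measurable_rectangle e a b \<Longrightarrow> a j < b j"
  unfolding measurable_rectangle_def by (blast intro: rectangle_nonempty_less)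

lemma measurable_rectangle_subset:
  assumes "measurable_rectangle e a b" "rectangle e a' b' \<noteq> {}"
    and le: "\<And>j. a j \<le> a' j" "\<And>j. b' j \<le> b j"
  shows "measurable_rectangle e a' b'"
proof -
  have less: "a' j < b' j" for j by (rule rectangle_nonempty_less) fact
  obtain A B where AB: "\<And>j. \<bar>a j\<bar> \<le> A" "\<And>j. \<bar>b j\<bar> \<le> B"
    using assms(1) by (force simp: measurable_rectangle_def bounded_iff)
  have "\<bar>a' j\<bar> \<le> A + B" "\<bar>b' j\<bar> \<le> A + B" for j
    using AB[of j] le[of j] less[of j] by linarith+
  then have "bounded (range a')" "bounded (range b')"
    by (auto simp: bounded_iff)
  moreover have "summable (\<lambda>j. max 0 (ln (b' j - a' j)))"
  proof (rule summable_comparison_test')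
    show "summable (\<lambda>j. max 0 (ln (b j - a j)))"
      using assms(1) by (simp add: measurable_rectangle_def)
    fix j :: nat
    have "ln (b' j - a' j) \<le> ln (b j - a j)"
      using le[of j] less[of j] by (subst ln_le_cancel_iff) linarith+
    then show "norm (max 0 (ln (b' j - a' j))) \<le> max 0 (ln (b j - a j))"
      by auto
  qed
  ultimately show ?thesis using assms(2) by (simp add: measurable_rectangle_def)
qed

lemma measurable_rectangle_inter:
  assumes "measurable_rectangle e (fst p) (snd p)"
    and "rectangle e (fst p) (snd p) \<inter> rectangle e (fst q) (snd q) \<noteq> {}"
  shows "measurable_rectangle e (fst (box_inter p q)) (snd (box_inter p q))"
  by (rule measurable_rectangle_subset[OF assms(1)])
    (use assms(2) rectangle_box_inter[of e p q] in \<open>auto simp: box_inter_def\<close>)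

text \<open>If the logarithms are not summable, their negative parts diverge, because the positive
  parts converge. The partial products then tend to 0, the default value in
  \<open>rectangle_vol\<close>.\<close>

lemma measurable_rectangle_LIMSEQ_prod:
  assumes "measurable_rectangle e a b"
  shows "(\<lambda>n. \<Prod>j<n. b j - a j) \<longlonglongrightarrow> rectangle_vol a b"
proof -
  let ?l = "\<lambda>j. ln (b j - a j)"
  have less: "a j < b j" for j by (rule measurable_rectangle_less) fact
  have prod: "(\<Prod>j<n. b j - a j) = exp (\<Sum>j<n. ?l j)" for n
    using less by (simp add: exp_sum)
  have p: "summable (\<lambda>j. max 0 (?l j))"
    using assms by (simp add: measurable_rectangle_def)
  show ?thesis
  proof (cases "summable ?l")
    case True
    then show ?thesis unfolding prod rectangle_vol_def
      by (auto intro!: tendsto_exp summable_LIMSEQ)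
  next
    case False
    have l: "?l j = max 0 (?l j) - max 0 (- ?l j)" for j by auto
    have q: "\<not> summable (\<lambda>j. max 0 (- ?l j))"
    proof
      assume "summable (\<lambda>j. max 0 (- ?l j))"
      from summable_diff[OF p this] False show False unfolding l[symmetric] by contradiction
    qed
    have "filterlim (\<lambda>n. \<Sum>j<n. ?l j) at_bot sequentially"
      unfolding filterlim_at_bot
    proof
      fix Z :: real
      have "\<not> (\<forall>n. (\<Sum>j<n. max 0 (- ?l j)) \<le> (\<Sum>j. max 0 (?l j)) - Z)"
        using q summableI_nonneg_bounded[of "\<lambda>j. max 0 (- ?l j)" "(\<Sum>j. max 0 (?l j)) - Z"]
        by (meson max.cobounded1)
      then obtain N where N: "(\<Sum>j<N. max 0 (- ?l j)) > (\<Sum>j. max 0 (?l j)) - Z"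
        by (auto simp: not_le)
      have "(\<Sum>j<n. ?l j) \<le> Z" if "n \<ge> N" for n
      proof -
        have "(\<Sum>j<n. ?l j) = (\<Sum>j<n. max 0 (?l j)) - (\<Sum>j<n. max 0 (- ?l j))"
          by (subst sum_subtractf[symmetric]) (auto intro!: sum.cong)
        also have "\<dots> \<le> (\<Sum>j. max 0 (?l j)) - (\<Sum>j<N. max 0 (- ?l j))"
          using that by (intro diff_mono sum_le_suminf[OF p] sum_mono2) auto
        finally show ?thesis using N by linarith
      qed
      then show "eventually (\<lambda>n. (\<Sum>j<n. ?l j) \<le> Z) sequentially"
        by (rule eventually_sequentiallyI)
    qed
    from filterlim_compose[OF exp_at_bot this] show ?thesis
      unfolding prod using False by (simp add: rectangle_vol_def)
  qed
qed

lemma measurable_rectangle_box_vol: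
  assumes "measurable_rectangle e (fst p) (snd p)"
  shows "finite_vol p" "box_vol p = rectangle_vol (fst p) (snd p)"
proof -
  have "max 0 (snd p j - fst p j) = snd p j - fst p j" for j
    using measurable_rectangle_less[OF assms, of j] by simp
  then have "(\<lambda>n. \<Prod>j<n. max 0 (snd p j - fst p j)) \<longlonglongrightarrow> rectangle_vol (fst p) (snd p)"
    using measurable_rectangle_LIMSEQ_prod[OF assms] by simp
  then show "finite_vol p" "box_vol p = rectangle_vol (fst p) (snd p)"
    by (auto simp: finite_vol_def box_vol_def convergent_def limI)
qed

text \<open>Clamping the coordinates of \<open>t\<close> between \<open>- Y\<close> and \<open>Y\<close>, where \<open>Y\<close> is square summable and
  dominates a point of each rectangle, moves them towards those points, hence keeps \<open>t\<close> in every box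
  that contains it. Finitely many coordinates, left unchanged, witness the boxes not containing it.\<close>

lemma ex_same_boxes:
  fixes e :: "nat \<Rightarrow> 'a::{real_inner, complete_space}"
  assumes e: "orthonormal_basis e" and "finite K"
    and ne: "\<And>p. p \<in> K \<Longrightarrow> rectangle e (fst p) (snd p) \<noteq> {}"
  shows "\<exists>x. \<forall>p\<in>K. x \<in> rectangle e (fst p) (snd p) \<longleftrightarrow> t \<in> seq_box p"
proof -
  from ne have "\<forall>p\<in>K. \<exists>y. y \<in> rectangle e (fst p) (snd p)" by blast
  then obtain y where y: "\<And>p. p \<in> K \<Longrightarrow> y p \<in> rectangle e (fst p) (snd p)" by metis
  define Y where "Y j = (\<Sum>p\<in>K. \<bar>y p \<bullet> e j\<bar>)" for j
  have Y: "\<bar>y p \<bullet> e j\<bar> \<le> Y j" if "p \<in> K" for p j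
    unfolding Y_def using that \<open>finite K\<close> by (intro member_le_sum) auto
  have Ysq: "summable (\<lambda>j. (Y j)\<^sup>2)"
  proof (rule summable_comparison_test')
    show "summable (\<lambda>j. real (card K) * (\<Sum>p\<in>K. (y p \<bullet> e j)\<^sup>2))"
      by (intro summable_mult summable_sum) (use onb_parseval[OF e] in \<open>auto simp: sums_iff\<close>)
    fix j :: nat
    have "(Y j)\<^sup>2 \<le> real (card K) * (\<Sum>p\<in>K. \<bar>y p \<bullet> e j\<bar>\<^sup>2)"
      unfolding Y_def using sum_squared_le_sum_of_squares[of "\<lambda>p. \<bar>y p \<bullet> e j\<bar>" K] by (simp add: mult.commute)
    then show "norm ((Y j)\<^sup>2) \<le> real (card K) * (\<Sum>p\<in>K. (y p \<bullet> e j)\<^sup>2)" by simp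
  qed
  have "\<forall>p\<in>{p\<in>K. t \<notin> seq_box p}. \<exists>j. \<not> (fst p j \<le> t j \<and> t j < snd p j)"
    by (auto simp: seq_box_def)
  then obtain w where w: "\<And>p. p \<in> K \<Longrightarrow> t \<notin> seq_box p \<Longrightarrow> \<not> (fst p (w p) \<le> t (w p) \<and> t (w p) < snd p (w p))"
    by (metis (mono_tags, lifting) mem_Collect_eq)
  define s where "s j = (if j \<in> w ` K then t j else max (- Y j) (min (Y j) (t j)))" for j
  have Y0: "Y j \<ge> 0" for j by (simp add: Y_def sum_nonneg)
  have "summable (\<lambda>j. (s j)\<^sup>2)"
  proof (rule summable_comparison_test_ev[OF _ Ysq])
    obtain n0 where "w ` K \<subseteq> {..<n0}"
      using finite_nat_iff_bounded[of "w ` K"] \<open>finite K\<close> by auto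
    then have "eventually (\<lambda>j. j \<notin> w ` K) sequentially"
      by (intro eventually_sequentiallyI[of n0]) auto
    then show "eventually (\<lambda>j. norm ((s j)\<^sup>2) \<le> (Y j)\<^sup>2) sequentially"
    proof eventually_elim
      case (elim j)
      then have "\<bar>s j\<bar> \<le> \<bar>Y j\<bar>" using Y0[of j] by (auto simp: s_def)
      then show ?case by (simp add: abs_le_square_iff)
    qed
  qed
  then obtain x where x: "\<And>j. x \<bullet> e j = s j" using riesz_fischer[OF e] by blast
  have "x \<in> rectangle e (fst p) (snd p) \<longleftrightarrow> t \<in> seq_box p" if p: "p \<in> K" for p
  proof (cases "t \<in> seq_box p")
    case True
    have "fst p j \<le> s j \<and> s j < snd p j" for j
    proof -
      have "fst p j \<le> t j" "t j < snd p j" using True by (auto simp: seq_box_def)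
      moreover have "fst p j \<le> y p \<bullet> e j" "y p \<bullet> e j < snd p j"
        using y[OF p] by (auto simp: rectangle_def)
      ultimately show ?thesis using Y[OF p, of j] by (auto simp: s_def)
    qed
    then show ?thesis using True by (auto simp: rectangle_def x)
  next
    case False
    have "s (w p) = t (w p)" using p by (simp add: s_def)
    then have "\<not> (fst p (w p) \<le> s (w p) \<and> s (w p) < snd p (w p))" using w[OF p False] by simp
    then show ?thesis using False by (auto simp: rectangle_def x)
  qed
  then show ?thesis by blast
qed

section \<open>Formal linear combinations of rectangles\<close>

definition rect_combs :: "(nat \<Rightarrow> 'a::real_inner) \<Rightarrow> (real \<times> seq_bounds) list set" where
  "rect_combs e = {L. \<forall>(c, p)\<in>set L. measurable_rectangle e (fst p) (snd p)}"

definition rect_fun :: "(nat \<Rightarrow> 'a::real_inner) \<Rightarrow> (real \<times> seq_bounds) list \<Rightarrow> 'a \<Rightarrow> real" where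
  "rect_fun e L x = (\<Sum>(c, p)\<leftarrow>L. c * indicator (rectangle e (fst p) (snd p)) x)"

text \<open>Computed from the bounds in the list, hence a priori dependent on the list and not only
  on the function \<open>rect_fun e L\<close>; \<open>comb_vol_cong\<close> removes this
  dependence.\<close>

definition comb_vol :: "(real \<times> seq_bounds) list \<Rightarrow> real" where
  "comb_vol L = (\<Sum>(c, p)\<leftarrow>L. c * box_vol p)"

definition scale_comb :: "real \<Rightarrow> (real \<times> seq_bounds) list \<Rightarrow> (real \<times> seq_bounds) list" where
  "scale_comb r = map (\<lambda>(c, p). (r * c, p))"

lemma rect_combs_simps [simp]:
  "[] \<in> rect_combs e"
  "(c, p) # L \<in> rect_combs e \<longleftrightarrow> measurable_rectangle e (fst p) (snd p) \<and> L \<in> rect_combs e"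
  "L @ L' \<in> rect_combs e \<longleftrightarrow> L \<in> rect_combs e \<and> L' \<in> rect_combs e"
  by (auto simp: rect_combs_def)

lemma rect_fun_simps [simp]:
  "rect_fun e [] x = 0"
  "rect_fun e ((c, p) # L) x = c * indicator (rectangle e (fst p) (snd p)) x + rect_fun e L x"
  "rect_fun e (L @ L') x = rect_fun e L x + rect_fun e L' x"
  by (auto simp: rect_fun_def)

lemma comb_vol_simps [simp]:
  "comb_vol [] = 0"
  "comb_vol ((c, p) # L) = c * box_vol p + comb_vol L"
  "comb_vol (L @ L') = comb_vol L + comb_vol L'"
  by (auto simp: comb_vol_def)

lemma scale_comb [simp]:
  "scale_comb r L \<in> rect_combs e \<longleftrightarrow> L \<in> rect_combs e"
  "rect_fun e (scale_comb r L) x = r * rect_fun e L x"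
  "comb_vol (scale_comb r L) = r * comb_vol L"
  by (induction L) (auto simp: scale_comb_def algebra_simps)

text \<open>Nonnegativity is given at points of the space, but \<open>vol_out_nonneg\<close> asks
  for it at every sequence \<open>t\<close>. A point lying in the same boxes of the list as
  \<open>t\<close> makes the two sums equal.\<close>

lemma comb_vol_nonneg:
  fixes e :: "nat \<Rightarrow> 'a::{real_inner, complete_space}"
  assumes e: "orthonormal_basis e" and L: "L \<in> rect_combs e" and nonneg: "\<And>x. rect_fun e L x \<ge> 0"
  shows "comb_vol L \<ge> 0"
proof -
  have mr: "measurable_rectangle e (fst p) (snd p)" if "(c, p) \<in> set L" for c p
    using L that by (auto simp: rect_combs_def)
  have "(\<Sum>(c, p)\<leftarrow>L. c * vol_out [] p) \<ge> 0"
  proof (rule vol_out_nonneg)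
    show "finite_vol p" if "(c, p) \<in> set L" for c p
      using mr[OF that] by (rule measurable_rectangle_box_vol)
    fix t :: "nat \<Rightarrow> real"
    have "\<exists>x. \<forall>p\<in>snd ` set L. x \<in> rectangle e (fst p) (snd p) \<longleftrightarrow> t \<in> seq_box p"
      by (rule ex_same_boxes[OF e]) (use mr in \<open>auto simp: measurable_rectangle_def\<close>)
    then obtain x where x: "\<And>p. p \<in> snd ` set L \<Longrightarrow> x \<in> rectangle e (fst p) (snd p) \<longleftrightarrow> t \<in> seq_box p"
      by blast
    have "(\<Sum>(c, p)\<leftarrow>L. c * indicator (seq_box p) t) = rect_fun e L x"
      unfolding rect_fun_def
      by (rule arg_cong[of _ _ sum_list], rule map_cong) (use x in \<open>force simp: indicator_def\<close>)+
    then show "(\<Sum>(c, p)\<leftarrow>L. c * indicator (seq_box p) t) \<ge> (0::real)" using nonneg[of x] by simp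
  qed
  then show ?thesis by (simp add: comb_vol_def)
qed

text \<open>Positivity applied to both differences. This makes the volume of a represented set well
  defined.\<close>

lemma comb_vol_cong:
  fixes e :: "nat \<Rightarrow> 'a::{real_inner, complete_space}"
  assumes "orthonormal_basis e" "L \<in> rect_combs e" "L' \<in> rect_combs e"
    and eq: "\<And>x. rect_fun e L x = rect_fun e L' x"
  shows "comb_vol L = comb_vol L'"
proof (rule antisym)
  show "comb_vol L \<le> comb_vol L'"
    using comb_vol_nonneg[of e "L' @ scale_comb (-1) L"] assms by simp
  show "comb_vol L' \<le> comb_vol L"
    using comb_vol_nonneg[of e "L @ scale_comb (-1) L'"] assms by simp
qed

definition represents :: "(nat \<Rightarrow> 'a::real_inner) \<Rightarrow> (real \<times> seq_bounds) list \<Rightarrow> 'a set \<Rightarrow> bool" where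
  "represents e L A \<longleftrightarrow> L \<in> rect_combs e \<and> (\<forall>x. indicator A x = rect_fun e L x)"

text \<open>Intersections of rectangles are rectangles; an empty one has to be dropped, since
  \<open>measurable_rectangle\<close> demands a point.\<close>

lemma rect_fun_mult_rectangle:
  assumes "L \<in> rect_combs e" "measurable_rectangle e (fst p) (snd p)"
  shows "\<exists>L'\<in>rect_combs e. \<forall>x. rect_fun e L' x = rect_fun e L x * indicator (rectangle e (fst p) (snd p)) x"
  using assms
proof (induction L)
  case Nil
  then show ?case by (intro bexI[of _ "[]"]) auto
next
  case (Cons cq L)
  obtain c q where cq: "cq = (c, q)" by (cases cq)
  obtain L' where L': "L' \<in> rect_combs e"
    "\<And>x. rect_fun e L' x = rect_fun e L x * indicator (rectangle e (fst p) (snd p)) x"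
    using Cons cq by auto
  let ?I = "rectangle e (fst q) (snd q) \<inter> rectangle e (fst p) (snd p)"
  have ind: "indicator ?I x = (indicator (rectangle e (fst q) (snd q)) x * indicator (rectangle e (fst p) (snd p)) x :: real)" for x
    by (rule indicator_inter_arith)
  show ?case
  proof (cases "?I = {}")
    case True
    then have "indicator (rectangle e (fst q) (snd q)) x * indicator (rectangle e (fst p) (snd p)) x = (0::real)" for x
      using ind[of x] by simp
    then show ?thesis
      by (intro bexI[of _ L'] L'(1)) (auto simp: L' cq distrib_right mult.assoc)
  next
    case False
    then have "(c, box_inter q p) # L' \<in> rect_combs e"
      using measurable_rectangle_inter[OF _ False] Cons.prems L'(1) by (simp add: cq)
    then show ?thesis
      by (intro bexI[of _ "(c, box_inter q p) # L'"])
        (auto simp: L' cq distrib_right mult.assoc rectangle_box_inter ind simp del: indicator_inter_arith)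
  qed
qed

lemma rect_fun_mult:
  assumes "L \<in> rect_combs e" "K \<in> rect_combs e"
  shows "\<exists>L'\<in>rect_combs e. \<forall>x. rect_fun e L' x = rect_fun e L x * rect_fun e K x"
  using assms(2)
proof (induction K)
  case Nil
  then show ?case by (intro bexI[of _ "[]"]) auto
next
  case (Cons cp K)
  obtain c p where cp: "cp = (c, p)" by (cases cp)
  obtain L1 where L1: "L1 \<in> rect_combs e" "\<And>x. rect_fun e L1 x = rect_fun e L x * rect_fun e K x"
    using Cons cp by auto
  obtain L2 where L2: "L2 \<in> rect_combs e"
    "\<And>x. rect_fun e L2 x = rect_fun e L x * indicator (rectangle e (fst p) (snd p)) x"
    using rect_fun_mult_rectangle[OF assms(1)] Cons.prems cp by fastforce
  show ?case
    by (intro bexI[of _ "scale_comb c L2 @ L1"]) (auto simp: L1 L2 cp algebra_simps)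
qed

text \<open>The indicator of \<open>A - B\<close> is 1_A - 1_A 1_B and that of
  \<open>A \<union> B\<close> is 1_A + 1_B - 1_A 1_B, and products of combinations are again
  combinations.\<close>

lemma represents_ring: "ring_of_sets UNIV {A. \<exists>L. represents e L A}"
  unfolding ring_of_sets_iff
proof (intro conjI ballI)
  show "{} \<in> {A. \<exists>L. represents e L A}"
    by (auto simp: represents_def intro!: exI[of _ "[]"])
  fix A B assume "A \<in> {A. \<exists>L. represents e L A}" "B \<in> {A. \<exists>L. represents e L A}"
  then obtain L K where LK: "represents e L A" "represents e K B" by auto
  then obtain M where M: "M \<in> rect_combs e" "\<And>x. rect_fun e M x = rect_fun e L x * rect_fun e K x"
    using rect_fun_mult unfolding represents_def by blast
  have eqs: "rect_fun e L x = indicator A x" "rect_fun e K x = indicator B x"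
    "rect_fun e M x = indicator A x * indicator B x" for x
    using LK M by (simp_all add: represents_def)
  have "represents e (L @ scale_comb (-1) M) (A - B)"
    using LK M(1) by (auto simp: represents_def eqs indicator_def)
  moreover have "represents e (L @ K @ scale_comb (-1) M) (A \<union> B)"
    using LK M(1) by (auto simp: represents_def eqs indicator_def)
  ultimately show "A \<union> B \<in> {A. \<exists>L. represents e L A}" "A - B \<in> {A. \<exists>L. represents e L A}"
    by auto
qed auto

lemma represents_rectangle:
  "measurable_rectangle e a b \<Longrightarrow> represents e [(1, (a, b))] (rectangle e a b)"
  by (simp add: represents_def)

section \<open>The generated ring and its translations\<close>

lemma rect_ring_ring: "ring_of_sets UNIV (rect_ring e)"
  unfolding ring_of_sets_iff rect_ring_def by (auto simp: ring_of_sets_iff)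

lemma rectangles_subset_rect_ring: "rectangles e \<subseteq> rect_ring e"
  by (auto simp: rect_ring_def)

lemma rect_ring_minimal:
  "ring_of_sets UNIV R \<Longrightarrow> rectangles e \<subseteq> R \<Longrightarrow> rect_ring e \<subseteq> R"
  by (auto simp: rect_ring_def)

lemma rect_ring_represents: "A \<in> rect_ring e \<Longrightarrow> \<exists>L. represents e L A"
proof -
  have "rect_ring e \<subseteq> {A. \<exists>L. represents e L A}"
  proof (intro rect_ring_minimal represents_ring)
    have "represents e [] {}" by (simp add: represents_def)
    then show "rectangles e \<subseteq> {A. \<exists>L. represents e L A}"
      unfolding rectangles_def using represents_rectangle by blast
  qed
  then show "A \<in> rect_ring e \<Longrightarrow> \<exists>L. represents e L A" by auto
qed

lemma rectangle_translate:
  "(+) h ` rectangle e a b = rectangle e (\<lambda>j. a j + h \<bullet> e j) (\<lambda>j. b j + h \<bullet> e j)"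
proof -
  have "x \<in> (+) h ` rectangle e a b \<longleftrightarrow> x - h \<in> rectangle e a b" for x
    by (auto simp: image_iff intro: bexI[of _ "x - h"])
  then show ?thesis
    by (simp add: set_eq_iff rectangle_def inner_diff_left le_diff_eq diff_less_eq)
qed

text \<open>The coordinates of \<open>h\<close> are bounded by \<open>norm h\<close>, and a
  translation leaves the side lengths alone.\<close>

lemma measurable_rectangle_translate:
  assumes "orthonormal_basis e" "measurable_rectangle e a b"
  shows "measurable_rectangle e (\<lambda>j. a j + h \<bullet> e j) (\<lambda>j. b j + h \<bullet> e j)"
proof -
  have "\<bar>h \<bullet> e j\<bar> \<le> norm h" for j
    using Cauchy_Schwarz_ineq2[of h "e j"] assms(1) by simp
  then have h: "bounded (range (\<lambda>j. h \<bullet> e j))" by (auto simp: bounded_iff)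
  have "rectangle e (\<lambda>j. a j + h \<bullet> e j) (\<lambda>j. b j + h \<bullet> e j) \<noteq> {}"
    using assms(2) by (simp add: rectangle_translate[symmetric] measurable_rectangle_def)
  moreover have "bounded (range (\<lambda>j. a j + h \<bullet> e j))" "bounded (range (\<lambda>j. b j + h \<bullet> e j))"
    using assms(2) bounded_plus_comp[OF _ h] by (auto simp: measurable_rectangle_def)
  ultimately show ?thesis using assms(2) by (simp add: measurable_rectangle_def)
qed

text \<open>The sets whose translate by \<open>h\<close> lies in the ring themselves form a ring
  containing the rectangles.\<close>

lemma rect_ring_translate:
  assumes e: "orthonormal_basis e" and "A \<in> rect_ring e"
  shows "(+) h ` A \<in> rect_ring e"
proof -
  interpret ring_of_sets UNIV "rect_ring e" by (rule rect_ring_ring)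
  have "rect_ring e \<subseteq> {A. (+) h ` A \<in> rect_ring e}"
  proof (rule rect_ring_minimal)
    show "ring_of_sets UNIV {A. (+) h ` A \<in> rect_ring e}"
      unfolding ring_of_sets_iff by (auto simp: image_Un image_set_diff)
    show "rectangles e \<subseteq> {A. (+) h ` A \<in> rect_ring e}"
      using measurable_rectangle_translate[OF e] rectangles_subset_rect_ring[of e]
      by (fastforce simp: rectangles_def rectangle_translate)
  qed
  with assms(2) show ?thesis by auto
qed

lemma represents_translate:
  fixes h :: "'a::real_inner"
  assumes e: "orthonormal_basis e" and L: "represents e L A"
  defines "L' \<equiv> map (\<lambda>(c, p). (c, (\<lambda>j. fst p j + h \<bullet> e j, \<lambda>j. snd p j + h \<bullet> e j))) L"
  shows "represents e L' ((+) h ` A)" "comb_vol L' = comb_vol L"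
proof -
  have "L \<in> rect_combs e" using L by (simp add: represents_def)
  then have "L' \<in> rect_combs e"
    by (auto simp: L'_def rect_combs_def intro!: measurable_rectangle_translate[OF e])
  moreover have "rect_fun e L' x = rect_fun e L (x - h)" for x
    unfolding L'_def
    by (induction L) (auto simp: rect_fun_def indicator_def rectangle_def inner_diff_left le_diff_eq diff_less_eq)
  moreover have "indicator ((+) h ` A) x = (indicator A (x - h) :: real)" for x
    by (auto simp: indicator_def image_iff intro: bexI[of _ "x - h"])
  ultimately show "represents e L' ((+) h ` A)"
    using L by (simp add: represents_def)
  show "comb_vol L' = comb_vol L"
    unfolding L'_def by (induction L) (auto simp: comb_vol_def box_vol_def)
qed

text \<open>\<open>rect_measure\<close> is a choice by \<open>SOME\<close>, so its properties are
  available only once some set function is shown to have them. The volume of any representing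
  combination is such a function.\<close>

lemma is_rect_measure_rect_measure:
  fixes e :: "nat \<Rightarrow> 'a::{real_inner, complete_space}"
  assumes e: "orthonormal_basis e"
  shows "is_rect_measure e (rect_measure e)"
proof -
  define \<mu> where "\<mu> A = comb_vol (SOME L. represents e L A)" for A
  have \<mu>: "\<mu> A = comb_vol L" if L: "represents e L A" for L A
  proof -
    define K where "K = (SOME L. represents e L A)"
    have K: "represents e K A"
      unfolding K_def by (rule someI[of "\<lambda>L. represents e L A", OF L])
    have "rect_fun e K x = rect_fun e L x" for x
      using K L unfolding represents_def by metis
    then have "comb_vol K = comb_vol L"
      using K L by (intro comb_vol_cong[OF e]) (simp_all add: represents_def)
    then show ?thesis by (simp only: \<mu>_def K_def)
  qed
  have "is_rect_measure e \<mu>"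
    unfolding is_rect_measure_def
  proof (intro conjI allI ballI impI)
    show "\<mu> {} = 0" using \<mu>[of "[]" "{}"] by (simp add: represents_def)
    show "\<mu> (rectangle e a b) = rectangle_vol a b" if "measurable_rectangle e a b" for a b
      using \<mu>[OF represents_rectangle[OF that]] measurable_rectangle_box_vol(2)[of e "(a, b)"] that by simp
    fix A assume A: "A \<in> rect_ring e"
    then obtain L where L: "represents e L A" using rect_ring_represents by blast
    then have LA: "rect_fun e L x = indicator A x" for x by (simp add: represents_def)
    have "comb_vol L \<ge> 0"
      by (rule comb_vol_nonneg[OF e]) (use L in \<open>auto simp: represents_def LA\<close>)
    then show "\<mu> A \<ge> 0" using \<mu>[OF L] by simp
    show "(+) h ` A \<in> rect_ring e" for h by (rule rect_ring_translate[OF e A])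
    show "\<mu> ((+) h ` A) = \<mu> A" for h
      using \<mu>[OF represents_translate(1)[OF e L]] represents_translate(2)[OF e L] \<mu>[OF L] by simp
    fix B assume B: "B \<in> rect_ring e" and AB: "A \<inter> B = {}"
    obtain K where K: "represents e K B" using rect_ring_represents B by blast
    have KB: "rect_fun e K x = indicator B x" for x using K by (simp add: represents_def)
    have "represents e (L @ K) (A \<union> B)"
      using L K AB unfolding represents_def rect_fun_simps LA KB
      by (auto simp: represents_def indicator_def)
    from \<mu>[OF this] show "\<mu> (A \<union> B) = \<mu> A + \<mu> B" using \<mu>[OF L] \<mu>[OF K] by simp
  qed
  then show ?thesis unfolding rect_measure_def using someI[of "is_rect_measure e" \<mu>] by blast
qed

subsection \<open>Positive ring elements contain rectangles\<close>

lemma rectangles_Int: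
  assumes "p \<in> rectangles e" "q \<in> rectangles e"
  shows "p \<inter> q \<in> rectangles e"
proof (cases "p \<inter> q = {}")
  case False
  with assms obtain a b c d where *: "measurable_rectangle e a b" "p = rectangle e a b"
    "measurable_rectangle e c d" "q = rectangle e c d"
    by (auto simp: rectangles_def)
  then have "measurable_rectangle e (fst (box_inter (a, b) (c, d))) (snd (box_inter (a, b) (c, d)))"
    using False by (intro measurable_rectangle_inter) auto
  moreover have "p \<inter> q = rectangle e (fst (box_inter (a, b) (c, d))) (snd (box_inter (a, b) (c, d)))"
    unfolding rectangle_box_inter by (simp add: *)
  ultimately show ?thesis by (auto simp: rectangles_def)
qed (simp add: rectangles_def)

text \<open>A normal form for ring elements, in which a pair \<open>(p, X)\<close> stands for
  \<open>p - \<Union>X\<close>. The pieces may overlap, which subadditivity tolerates.\<close>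

definition rect_pieces :: "(nat \<Rightarrow> 'a::real_inner) \<Rightarrow> ('a set \<times> 'a set set) set \<Rightarrow> bool" where
  "rect_pieces e P \<longleftrightarrow> finite P \<and> (\<forall>(p, X)\<in>P. p \<in> rectangles e \<and> finite X \<and> X \<subseteq> rectangles e)"

definition pieces_union :: "('a set \<times> 'a set set) set \<Rightarrow> 'a set" where
  "pieces_union P = (\<Union>(p, X)\<in>P. p - \<Union>X)"

lemma pieces_union_Un: "pieces_union (P \<union> Q) = pieces_union P \<union> pieces_union Q"
  by (simp add: pieces_union_def)

text \<open>What remains of \<open>p - \<Union>X\<close> are the points outside \<open>q\<close>,
  giving a piece with \<open>q\<close> added to \<open>X\<close>, and the points in some
  \<open>y\<close> of \<open>Y\<close>, giving pieces that start from
  \<open>p \<inter> y\<close>.\<close>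

lemma rect_pieces_Diff_piece:
  assumes P: "rect_pieces e P" and q: "q \<in> rectangles e" "finite Y" "Y \<subseteq> rectangles e"
  shows "\<exists>P'. rect_pieces e P' \<and> pieces_union P' = pieces_union P - (q - \<Union>Y)"
proof (intro exI conjI)
  let ?P' = "(\<lambda>(p, X). (p, insert q X)) ` P \<union> (\<lambda>((p, X), y). (p \<inter> y, X)) ` (P \<times> Y)"
  show "rect_pieces e ?P'"
  proof -
    have *: "p \<in> rectangles e" "finite X" "X \<subseteq> rectangles e" if "(p, X) \<in> P" for p X
      using P that by (auto simp: rect_pieces_def)
    have "finite ?P'" using P q(2) by (simp add: rect_pieces_def)
    moreover have "case s of (r, Z) \<Rightarrow> r \<in> rectangles e \<and> finite Z \<and> Z \<subseteq> rectangles e"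
      if "s \<in> ?P'" for s
    proof -
      obtain r Z where s: "s = (r, Z)" by (cases s)
      with that consider X where "(r, X) \<in> P" "Z = insert q X"
        | p y where "(p, Z) \<in> P" "y \<in> Y" "r = p \<inter> y" by fastforce
      then show ?thesis
      proof cases
        case 1
        then show ?thesis using *[OF 1(1)] q(1) s by simp
      next
        case 2
        then show ?thesis using *[OF 2(1)] q(3) s by (auto simp: rectangles_Int)
      qed
    qed
    ultimately show ?thesis unfolding rect_pieces_def by (intro conjI ballI)
  qed
  have "pieces_union ((\<lambda>(p, X). (p, insert q X)) ` P) = pieces_union P - q"
    by (auto simp: pieces_union_def case_prod_unfold)
  moreover have "pieces_union ((\<lambda>((p, X), y). (p \<inter> y, X)) ` (P \<times> Y)) = pieces_union P \<inter> \<Union>Y"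
    unfolding pieces_union_def case_prod_unfold image_image by (auto intro!: bexI)
  ultimately show "pieces_union ?P' = pieces_union P - (q - \<Union>Y)"
    by (simp only: pieces_union_Un) blast
qed

lemma rect_pieces_Diff:
  assumes "rect_pieces e P" "rect_pieces e Q"
  shows "\<exists>P'. rect_pieces e P' \<and> pieces_union P' = pieces_union P - pieces_union Q"
proof -
  have "finite Q" using assms(2) by (simp add: rect_pieces_def)
  then show ?thesis using assms(2)
  proof (induction Q)
    case empty
    then show ?case using assms(1) by (auto simp: pieces_union_def)
  next
    case (insert qY Q)
    obtain q Y where qY: "qY = (q, Y)" by (cases qY)
    have "rect_pieces e Q" "q \<in> rectangles e" "finite Y" "Y \<subseteq> rectangles e"
      using insert.prems by (simp_all add: rect_pieces_def qY)
    then obtain P1 P2 where P: "pieces_union P1 = pieces_union P - pieces_union Q"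
      "rect_pieces e P2" "pieces_union P2 = pieces_union P1 - (q - \<Union>Y)"
      using insert.IH rect_pieces_Diff_piece by meson
    have "pieces_union (insert qY Q) = (q - \<Union>Y) \<union> pieces_union Q"
      by (simp add: pieces_union_def qY)
    then have "pieces_union P2 = pieces_union P - pieces_union (insert qY Q)"
      unfolding P by blast
    then show ?case using P(2) by blast
  qed
qed

lemma rect_ring_pieces:
  assumes "A \<in> rect_ring e"
  shows "\<exists>P. rect_pieces e P \<and> A = pieces_union P"
proof -
  have "rect_ring e \<subseteq> {A. \<exists>P. rect_pieces e P \<and> A = pieces_union P}"
  proof (rule rect_ring_minimal)
    show "ring_of_sets UNIV {A. \<exists>P. rect_pieces e P \<and> A = pieces_union P}"
      unfolding ring_of_sets_iff
    proof (intro conjI ballI)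
      show "{} \<in> {A. \<exists>P. rect_pieces e P \<and> A = pieces_union P}"
        by (auto simp: rect_pieces_def pieces_union_def intro!: exI[of _ "{}"])
      fix A B assume "A \<in> {A. \<exists>P. rect_pieces e P \<and> A = pieces_union P}"
        "B \<in> {A. \<exists>P. rect_pieces e P \<and> A = pieces_union P}"
      then obtain P Q where PQ: "rect_pieces e P" "A = pieces_union P" "rect_pieces e Q" "B = pieces_union Q"
        by auto
      then have "rect_pieces e (P \<union> Q)" "A \<union> B = pieces_union (P \<union> Q)"
        by (auto simp: rect_pieces_def pieces_union_def)
      then show "A \<union> B \<in> {A. \<exists>P. rect_pieces e P \<and> A = pieces_union P}" by blast
      show "A - B \<in> {A. \<exists>P. rect_pieces e P \<and> A = pieces_union P}"
        using rect_pieces_Diff[of e P Q] PQ by auto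
    qed auto
    show "rectangles e \<subseteq> {A. \<exists>P. rect_pieces e P \<and> A = pieces_union P}"
    proof safe
      fix p assume "p \<in> rectangles e"
      then show "\<exists>P. rect_pieces e P \<and> p = pieces_union P"
        by (intro exI[of _ "{(p, {})}"]) (auto simp: rect_pieces_def pieces_union_def)
    qed
  qed
  with assms show ?thesis by auto
qed

lemma rect_ring_covered:
  assumes "A \<in> rect_ring e"
  shows "\<exists>X. finite X \<and> X \<subseteq> rectangles e \<and> A \<subseteq> \<Union>X"
proof -
  obtain P where P: "rect_pieces e P" "A = pieces_union P" using rect_ring_pieces[OF assms] by auto
  have "finite (fst ` P)" "fst ` P \<subseteq> rectangles e"
    using P(1) by (simp_all add: rect_pieces_def image_subset_iff case_prod_unfold)
  moreover have "A \<subseteq> \<Union>(fst ` P)" unfolding P(2) pieces_union_def case_prod_unfold by blast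
  ultimately show ?thesis by (intro exI[of _ "fst ` P"] conjI)
qed

section \<open>Rectangles of positive volume\<close>

lemma rectangle_mono:
  assumes "\<And>j. a j \<le> a' j" "\<And>j. b' j \<le> b j"
  shows "rectangle e a' b' \<subseteq> rectangle e a b"
  using assms by (fastforce simp: rectangle_def intro: order_trans less_le_trans)

text \<open>A measurable rectangle is fat iff \<open>rectangle_vol a b > 0\<close>.\<close>

definition fat_rectangle :: "(nat \<Rightarrow> 'a::real_inner) \<Rightarrow> (nat \<Rightarrow> real) \<Rightarrow> (nat \<Rightarrow> real) \<Rightarrow> bool" where
  "fat_rectangle e a b \<longleftrightarrow> measurable_rectangle e a b \<and> summable (\<lambda>j. ln (b j - a j))"

text \<open>Only finitely many logarithms change, so their summability survives.\<close>

lemma fat_rectangle_restrict: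
  assumes fat: "fat_rectangle e a b" and "x \<in> rectangle e a' b'"
    and "\<And>j. a j \<le> a' j" "\<And>j. b' j \<le> b j"
    and eq: "\<And>j. j \<ge> N \<Longrightarrow> a' j = a j" "\<And>j. j \<ge> N \<Longrightarrow> b' j = b j"
  shows "fat_rectangle e a' b'" "rectangle e a' b' \<subseteq> rectangle e a b"
proof -
  have "measurable_rectangle e a' b'"
    by (rule measurable_rectangle_subset[of e a b]) (use assms in \<open>auto simp: fat_rectangle_def\<close>)
  moreover have "summable (\<lambda>j. ln (b' j - a' j))"
  proof -
    have "eventually (\<lambda>j. ln (b' j - a' j) = ln (b j - a j)) sequentially"
      using eq by (intro eventually_sequentiallyI[of N]) simp
    then show ?thesis using fat by (simp add: summable_cong fat_rectangle_def)
  qed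
  ultimately show "fat_rectangle e a' b'" by (simp add: fat_rectangle_def)
  show "rectangle e a' b' \<subseteq> rectangle e a b"
    by (rule rectangle_mono) (fact assms(3,4))+
qed

text \<open>A point outside the cylinders over finitely many rectangles keeps its distance from each of
  them in one of the first \<open>N\<close> coordinates.\<close>

lemma ex_fat_rectangle_avoiding:
  assumes fat: "fat_rectangle e a b" and x: "x \<in> rectangle e a b" and "finite K"
    and out: "\<And>p. p \<in> K \<Longrightarrow> \<exists>j<N. \<not> (fst p j \<le> x \<bullet> e j \<and> x \<bullet> e j < snd p j)"
  shows "\<exists>a' b'. fat_rectangle e a' b' \<and>
    rectangle e a' b' \<subseteq> rectangle e a b - (\<Union>p\<in>K. rectangle e (fst p) (snd p))"
proof -
  \<comment> \<open>The new upper side stops at \<open>b j\<close> or at the first lower bound above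
    the coordinate of \<open>x\<close>. Rectangles that \<open>x\<close> has left through their
    upper bound are avoided by raising the lower side to that coordinate.\<close>
  define S where "S j = insert (b j) ((\<lambda>p. fst p j) ` {p \<in> K. x \<bullet> e j < fst p j})" for j
  define a' where "a' j = (if j < N then x \<bullet> e j else a j)" for j
  define b' where "b' j = (if j < N then Min (S j) else b j)" for j
  have S: "finite (S j)" "S j \<noteq> {}" "b j \<in> S j" for j
    using \<open>finite K\<close> by (auto simp: S_def)
  have xj: "a j \<le> x \<bullet> e j" "x \<bullet> e j < b j" for j using x by (auto simp: rectangle_def)
  have "x \<bullet> e j < Min (S j)" for j
    using S[of j] xj by (auto simp: S_def)
  then have x': "x \<in> rectangle e a' b'"
    using xj by (auto simp: rectangle_def a'_def b'_def)
  have "a j \<le> a' j" "b' j \<le> b j" for j using xj S by (auto simp: a'_def b'_def)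
  then have fat': "fat_rectangle e a' b'" "rectangle e a' b' \<subseteq> rectangle e a b"
    using fat_rectangle_restrict[OF fat x', of N] by (auto simp: a'_def b'_def)
  have "y \<notin> rectangle e (fst p) (snd p)" if y: "y \<in> rectangle e a' b'" and p: "p \<in> K" for y p
  proof
    assume yp: "y \<in> rectangle e (fst p) (snd p)"
    obtain j where j: "j < N" "\<not> (fst p j \<le> x \<bullet> e j \<and> x \<bullet> e j < snd p j)" using out[OF p] by auto
    have 1: "x \<bullet> e j \<le> y \<bullet> e j" "y \<bullet> e j < Min (S j)"
      using y j(1) by (auto simp: rectangle_def a'_def b'_def dest: spec[of _ j])
    have 2: "fst p j \<le> y \<bullet> e j" "y \<bullet> e j < snd p j"
      using yp by (auto simp: rectangle_def)
    show False
    proof (cases "x \<bullet> e j < fst p j")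
      case True
      then have "fst p j \<in> S j" using p by (auto simp: S_def)
      then have "Min (S j) \<le> fst p j" using S by simp
      then show False using 1 2 by simp
    qed (use 1 2 j in simp)
  qed
  then have "rectangle e a' b' \<subseteq> rectangle e a b - (\<Union>p\<in>K. rectangle e (fst p) (snd p))"
    using fat'(2) by blast
  then show ?thesis using fat'(1) by blast
qed

text \<open>From coordinate \<open>N\<close> on the factors are those of the outer rectangle, so the
  volume is the outer volume times a ratio of partial products. Fatness makes the limit of the
  denominators nonzero.\<close>

lemma fat_rectangle_vol_cylinder:
  assumes fat: "fat_rectangle e a b" and mr: "measurable_rectangle e a' b'"
    and sub: "\<And>j. a j \<le> a' j" "\<And>j. b' j \<le> b j"
  shows "(\<lambda>N. rectangle_vol (\<lambda>j. if j < N then a' j else a j) (\<lambda>j. if j < N then b' j else b j))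
    \<longlonglongrightarrow> rectangle_vol a' b'"
proof -
  let ?a = "\<lambda>N j. if j < N then a' j else a j" and ?b = "\<lambda>N j. if j < N then b' j else b j"
  let ?V = "rectangle_vol a b"
  have mab: "measurable_rectangle e a b" using fat by (simp add: fat_rectangle_def)
  have less: "a j < b j" "a' j < b' j" for j
    using measurable_rectangle_less mab mr by blast+
  have V: "?V > 0" using fat by (simp add: fat_rectangle_def rectangle_vol_def)
  have pos: "(\<Prod>j<N. b j - a j) > 0" for N by (intro prod_pos) (simp add: less)
  have vol: "rectangle_vol (?a N) (?b N) = (\<Prod>j<N. b' j - a' j) / (\<Prod>j<N. b j - a j) * ?V" for N
  proof (rule LIMSEQ_unique)
    obtain x where "x \<in> rectangle e a' b'" using mr by (auto simp: measurable_rectangle_def)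
    then have "x \<in> rectangle e (?a N) (?b N)"
      by (rule subsetD[OF rectangle_mono, rotated 2]) (simp_all add: sub)
    then have "measurable_rectangle e (?a N) (?b N)"
      by (intro measurable_rectangle_subset[OF mab]) (use sub in auto)
    then show "(\<lambda>n. \<Prod>j<n. ?b N j - ?a N j) \<longlonglongrightarrow> rectangle_vol (?a N) (?b N)"
      by (rule measurable_rectangle_LIMSEQ_prod)
    have "(\<Prod>j<n. ?b N j - ?a N j) = (\<Prod>j<N. b' j - a' j) / (\<Prod>j<N. b j - a j) * (\<Prod>j<n. b j - a j)"
      if "n \<ge> N" for n
    proof -
      have n: "{..<n} = {..<N} \<union> {N..<n}" using that by auto
      have "(\<Prod>j<n. ?b N j - ?a N j) = (\<Prod>j<N. b' j - a' j) * (\<Prod>j=N..<n. b j - a j)"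
        unfolding n by (subst prod.union_disjoint) auto
      moreover have "(\<Prod>j<n. b j - a j) = (\<Prod>j<N. b j - a j) * (\<Prod>j=N..<n. b j - a j)"
        unfolding n by (subst prod.union_disjoint) auto
      ultimately show ?thesis
        using less_imp_neq[OF pos[of N], symmetric] by (simp del: prod_zero_iff)
    qed
    then have ev: "eventually (\<lambda>n. (\<Prod>j<N. b' j - a' j) / (\<Prod>j<N. b j - a j) * (\<Prod>j<n. b j - a j)
        = (\<Prod>j<n. ?b N j - ?a N j)) sequentially"
      by (intro eventually_sequentiallyI[of N]) simp
    show "(\<lambda>n. \<Prod>j<n. ?b N j - ?a N j) \<longlonglongrightarrow> (\<Prod>j<N. b' j - a' j) / (\<Prod>j<N. b j - a j) * ?V"
      by (rule Lim_transform_eventually[OF _ ev])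
        (intro tendsto_mult tendsto_const measurable_rectangle_LIMSEQ_prod[OF mab])
  qed
  have "(\<lambda>N. (\<Prod>j<N. b' j - a' j) / (\<Prod>j<N. b j - a j) * ?V) \<longlonglongrightarrow> rectangle_vol a' b' / ?V * ?V"
    using V by (intro tendsto_mult tendsto_divide tendsto_const
        measurable_rectangle_LIMSEQ_prod[OF mab] measurable_rectangle_LIMSEQ_prod[OF mr]) simp
  then show ?thesis unfolding vol using V by simp
qed

section \<open>Finitely additive measures and pieces without fat rectangles\<close>

context
  fixes e :: "nat \<Rightarrow> 'a::real_inner" and \<mu>
  assumes \<mu>: "is_rect_measure e \<mu>"
begin

interpretation ring_of_sets UNIV "rect_ring e" by (rule rect_ring_ring)

lemma rect_measure_Diff:
  assumes "A \<in> rect_ring e" "B \<in> rect_ring e" "B \<subseteq> A"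
  shows "\<mu> (A - B) = \<mu> A - \<mu> B"
proof -
  have "\<mu> ((A - B) \<union> B) = \<mu> (A - B) + \<mu> B"
    using \<mu> assms unfolding is_rect_measure_def by blast
  then show ?thesis using assms by (simp add: Un_absorb2 Un_commute)
qed

lemma rect_measure_nonneg: "A \<in> rect_ring e \<Longrightarrow> 0 \<le> \<mu> A"
  using \<mu> unfolding is_rect_measure_def by blast

lemma rect_measure_mono:
  assumes "A \<in> rect_ring e" "B \<in> rect_ring e" "A \<subseteq> B"
  shows "\<mu> A \<le> \<mu> B"
  using rect_measure_Diff[OF assms(2,1,3)] rect_measure_nonneg[of "B - A"] assms by auto

lemma rect_measure_UN_le:
  assumes "finite I" "\<And>i. i \<in> I \<Longrightarrow> B i \<in> rect_ring e"
  shows "\<mu> (\<Union>i\<in>I. B i) \<le> (\<Sum>i\<in>I. \<mu> (B i))"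
  using assms
proof (induction I)
  case empty
  then show ?case using \<mu> by (simp add: is_rect_measure_def)
next
  case (insert i I)
  let ?U = "\<Union>i\<in>I. B i"
  have U: "?U \<in> rect_ring e" "B i \<in> rect_ring e" using insert by auto
  have "\<mu> (B i \<union> (?U - B i)) = \<mu> (B i) + \<mu> (?U - B i)"
    using \<mu> U unfolding is_rect_measure_def by (metis Diff Diff_disjoint)
  moreover have "\<mu> (?U - B i) \<le> \<mu> ?U" using U by (intro rect_measure_mono) auto
  ultimately show ?case using insert by simp
qed

text \<open>For each \<open>N\<close>, a point of the piece outside the cylinders over all removed
  rectangles \<open>R\<close> would supply a fat rectangle in the piece. Hence these cylinders, each
  minus its \<open>R\<close>, cover the piece, and the measure of this excess tends to 0 as
  \<open>N\<close> grows.\<close>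

lemma rect_measure_piece_null:
  assumes p: "p \<in> rectangles e" and X: "finite X" "X \<subseteq> rectangles e"
    and thin: "\<And>a b. fat_rectangle e a b \<Longrightarrow> \<not> rectangle e a b \<subseteq> p - \<Union>X"
  shows "\<mu> (p - \<Union>X) = 0"
proof -
  have ring: "p \<in> rect_ring e" "\<And>R. R \<in> X \<Longrightarrow> R \<in> rect_ring e" "\<Union>X \<in> rect_ring e"
    using p X rectangles_subset_rect_ring[of e] by auto
  have "\<mu> (p - \<Union>X) \<le> 0"
  proof (cases "p = {}")
    case True
    then show ?thesis using \<mu> by (simp add: is_rect_measure_def)
  next
    case False
    then obtain a b where ab: "measurable_rectangle e a b" "p = rectangle e a b"
      using p by (auto simp: rectangles_def)
    have \<mu>_rect: "\<mu> (rectangle e a b) = rectangle_vol a b" if "measurable_rectangle e a b" for a b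
      using \<mu> that by (simp add: is_rect_measure_def)
    show ?thesis
    proof (cases "fat_rectangle e a b")
      case False
      then have "\<mu> p = 0" using ab \<mu>_rect by (simp add: fat_rectangle_def rectangle_vol_def)
      then show ?thesis using rect_measure_mono[of "p - \<Union>X" p] ring by auto
    next
      case fat: True
      \<comment> \<open>Rectangles that miss \<open>p\<close> change nothing; each of the others
        meets \<open>p\<close> in a nonempty, hence measurable, rectangle.\<close>
      define Y where "Y = {R \<in> X. R \<inter> p \<noteq> {}}"
      have Y: "finite Y" "p - \<Union>X = p - \<Union>Y" using X by (auto simp: Y_def)
      have "\<forall>R\<in>Y. \<exists>q. measurable_rectangle e (fst q) (snd q) \<and> R = rectangle e (fst q) (snd q)"
        using X(2) by (fastforce simp: Y_def rectangles_def)
      then obtain q where q: "\<And>R. R \<in> Y \<Longrightarrow> measurable_rectangle e (fst (q R)) (snd (q R))"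
        "\<And>R. R \<in> Y \<Longrightarrow> R = rectangle e (fst (q R)) (snd (q R))" by metis
      define r where "r R = box_inter (a, b) (q R)" for R
      have r_le: "a j \<le> fst (r R) j" "snd (r R) j \<le> b j" for R j
        by (simp_all add: r_def box_inter_def)
      have r_rect: "rectangle e (fst (r R)) (snd (r R)) = p \<inter> R" if "R \<in> Y" for R
        using q(2)[OF that] by (simp add: r_def rectangle_box_inter ab(2))
      have r_mr: "measurable_rectangle e (fst (r R)) (snd (r R))" if "R \<in> Y" for R
        using that r_rect[OF that] by (intro measurable_rectangle_subset[OF ab(1)] r_le) (auto simp: Y_def)
      \<comment> \<open>\<open>C N R\<close> follows \<open>p \<inter> R\<close> in the first
        \<open>N\<close> coordinates and \<open>p\<close> in the rest.\<close>
      define ca where "ca N R j = (if j < N then fst (r R) j else a j)" for N R j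
      define cb where "cb N R j = (if j < N then snd (r R) j else b j)" for N R j
      define C where "C N R = rectangle e (ca N R) (cb N R)" for N R
      have C_sub: "p \<inter> R \<subseteq> C N R" if "R \<in> Y" for N R
        unfolding C_def r_rect[OF that, symmetric]
        by (rule rectangle_mono) (simp_all add: ca_def cb_def r_le)
      have C_mr: "measurable_rectangle e (ca N R) (cb N R)" if "R \<in> Y" for N R
        by (rule measurable_rectangle_subset[OF ab(1)])
          (use C_sub[OF that, of N] that r_le in \<open>auto simp: C_def Y_def ca_def cb_def\<close>)
      have C_ring: "C N R \<in> rect_ring e" if "R \<in> Y" for N R
        using C_mr[OF that] rectangles_subset_rect_ring[of e] by (auto simp: C_def rectangles_def)
      have C_p: "C N R \<inter> R = p \<inter> R" if "R \<in> Y" for N R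
      proof -
        have "C N R \<subseteq> p"
          unfolding C_def ab(2) by (rule rectangle_mono) (simp_all add: ca_def cb_def r_le)
        then show ?thesis using C_sub[OF that, of N] by auto
      qed
      have cover: "p - \<Union>Y \<subseteq> (\<Union>R\<in>Y. C N R - R)" for N
      proof
        fix x assume x: "x \<in> p - \<Union>Y"
        show "x \<in> (\<Union>R\<in>Y. C N R - R)"
        proof (rule ccontr)
          assume "x \<notin> (\<Union>R\<in>Y. C N R - R)"
          with x have notC: "x \<notin> C N R" if "R \<in> Y" for R using that by auto
          have "\<exists>j<N. \<not> (fst (q R) j \<le> x \<bullet> e j \<and> x \<bullet> e j < snd (q R) j)" if "R \<in> Y" for R
          proof (rule ccontr)
            assume *: "\<not> ?thesis"
            have "x \<in> rectangle e a b" using x ab by simp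
            with * have "x \<in> C N R"
              by (auto simp: C_def rectangle_def ca_def cb_def r_def box_inter_def)
            with notC[OF that] show False by simp
          qed
          then have "\<exists>j<N. \<not> (fst r j \<le> x \<bullet> e j \<and> x \<bullet> e j < snd r j)" if "r \<in> q ` Y" for r
            using that by blast
          then obtain a' b' where *: "fat_rectangle e a' b'"
            "rectangle e a' b' \<subseteq> rectangle e a b - (\<Union>p\<in>q ` Y. rectangle e (fst p) (snd p))"
            using ex_fat_rectangle_avoiding[OF fat, of x "q ` Y" N] x ab(2) Y(1) by blast
          moreover have "(\<Union>p\<in>q ` Y. rectangle e (fst p) (snd p)) = \<Union>Y"
            using q(2) by auto
          ultimately show False using thin[OF *(1)] Y(2) ab(2) by simp
        qed
      qed
      have "\<mu> (p - \<Union>X) \<le> (\<Sum>R\<in>Y. rectangle_vol (ca N R) (cb N R) - \<mu> (p \<inter> R))" for N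
      proof -
        have CR: "C N R - R \<in> rect_ring e" if "R \<in> Y" for R
          using that C_ring[OF that] ring(2) by (simp add: Y_def Diff)
        then have "(\<Union>R\<in>Y. C N R - R) \<in> rect_ring e"
          using Y(1) by (intro finite_UN)
        then have "\<mu> (p - \<Union>X) \<le> \<mu> (\<Union>R\<in>Y. C N R - R)"
          using cover[of N] Y(2) Diff[OF ring(1,3)] by (intro rect_measure_mono) simp_all
        also have "\<dots> \<le> (\<Sum>R\<in>Y. \<mu> (C N R - R))"
          by (intro rect_measure_UN_le Y(1) CR)
        also have "\<dots> = (\<Sum>R\<in>Y. rectangle_vol (ca N R) (cb N R) - \<mu> (p \<inter> R))"
        proof (rule sum.cong)
          fix R assume R: "R \<in> Y"
          have "C N R - R = C N R - p \<inter> R" using C_p[OF R, of N] by auto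
          moreover have "p \<inter> R \<in> rect_ring e" using R ring by (auto simp: Y_def)
          ultimately have "\<mu> (C N R - R) = \<mu> (C N R) - \<mu> (p \<inter> R)"
            using C_ring[OF R] C_sub[OF R] by (simp add: rect_measure_Diff)
          then show "\<mu> (C N R - R) = rectangle_vol (ca N R) (cb N R) - \<mu> (p \<inter> R)"
            using \<mu>_rect[OF C_mr[OF R, of N]] by (simp add: C_def)
        qed simp
        finally show ?thesis .
      qed
      moreover have "(\<lambda>N. \<Sum>R\<in>Y. rectangle_vol (ca N R) (cb N R) - \<mu> (p \<inter> R)) \<longlonglongrightarrow> (\<Sum>R\<in>Y. \<mu> (p \<inter> R) - \<mu> (p \<inter> R))"
      proof (intro tendsto_sum tendsto_diff tendsto_const)
        fix R assume R: "R \<in> Y"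
        have "\<mu> (p \<inter> R) = rectangle_vol (fst (r R)) (snd (r R))"
          using \<mu>_rect[OF r_mr[OF R]] r_rect[OF R] by simp
        then show "(\<lambda>N. rectangle_vol (ca N R) (cb N R)) \<longlonglongrightarrow> \<mu> (p \<inter> R)"
          using fat_rectangle_vol_cylinder[OF fat r_mr[OF R] r_le] by (simp add: ca_def[abs_def] cb_def[abs_def])
      qed
      ultimately show ?thesis
        by (intro LIMSEQ_le_const[where X = "\<lambda>N. \<Sum>R\<in>Y. rectangle_vol (ca N R) (cb N R) - \<mu> (p \<inter> R)"]) auto
    qed
  qed
  moreover have "0 \<le> \<mu> (p - \<Union>X)" using ring by (intro rect_measure_nonneg) auto
  ultimately show ?thesis by simp
qed

text \<open>Finite subadditivity over the pieces: if none contains a fat rectangle, all of them are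
  null.\<close>

lemma rect_measure_pos_imp_fat:
  assumes A: "A \<in> rect_ring e" "\<mu> A > 0"
  shows "\<exists>a b. fat_rectangle e a b \<and> rectangle e a b \<subseteq> A"
proof (rule ccontr)
  assume thin: "\<not> ?thesis"
  obtain P where P: "rect_pieces e P" "A = pieces_union P" using rect_ring_pieces[OF A(1)] by auto
  have piece: "p - \<Union>X \<in> rect_ring e \<and> \<mu> (p - \<Union>X) = 0" if "(p, X) \<in> P" for p X
  proof
    have pX: "p \<in> rectangles e" "finite X" "X \<subseteq> rectangles e" using P that by (auto simp: rect_pieces_def)
    then show "p - \<Union>X \<in> rect_ring e" using rectangles_subset_rect_ring[of e] by (intro Diff finite_Union) auto
    have "p - \<Union>X \<subseteq> A" using that P(2) by (auto simp: pieces_union_def)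
    then show "\<mu> (p - \<Union>X) = 0" using thin by (intro rect_measure_piece_null pX) blast
  qed
  have "\<mu> (\<Union>s\<in>P. fst s - \<Union>(snd s)) \<le> (\<Sum>s\<in>P. \<mu> (fst s - \<Union>(snd s)))"
    using P(1) piece by (intro rect_measure_UN_le) (auto simp: rect_pieces_def)
  also have "\<dots> = 0" using piece by (intro sum.neutral) auto
  finally show False using A(2) P(2) by (simp add: pieces_union_def case_prod_unfold)
qed

end

subsection \<open>Coverings of a rectangle by rectangles of another basis\<close>

text \<open>Only \<open>n\<close> coordinates of \<open>x0\<close> are moved, so that both points
  stay in the space; the sign of \<open>u \<bullet> f j\<close> decides which of the two moves up.
  The factor \<open>\<theta> < 1\<close> avoids the excluded upper ends.\<close>

lemma rectangle_spread:
  assumes f: "orthonormal_basis f" and x0: "x0 \<in> rectangle f a b" and \<theta>: "0 \<le> \<theta>" "\<theta> < 1"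
  shows "\<exists>x\<in>rectangle f a b. \<exists>y\<in>rectangle f a b.
    (x - y) \<bullet> u = \<theta> * (\<Sum>j<n. \<bar>u \<bullet> f j\<bar> * (b j - a j))"
proof -
  define move where "move s = x0 + (\<Sum>j<n. (s j - x0 \<bullet> f j) *\<^sub>R f j)" for s
  define hi where "hi j = a j + (if u \<bullet> f j \<ge> 0 then \<theta> else 0) * (b j - a j)" for j
  define lo where "lo j = a j + (if u \<bullet> f j \<ge> 0 then 0 else \<theta>) * (b j - a j)" for j
  have x0j: "a j \<le> x0 \<bullet> f j" "x0 \<bullet> f j < b j" for j using x0 by (auto simp: rectangle_def)
  then have less: "a j < b j" for j by (meson le_less_trans)
  have move_in: "move s \<in> rectangle f a b" if "\<And>j. a j \<le> s j" "\<And>j. s j < b j" for s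
  proof -
    have "move s \<bullet> f j = (if j < n then s j else x0 \<bullet> f j)" for j
      using onb_inner_sum[OF f, of "{..<n}" "\<lambda>j. s j - x0 \<bullet> f j" j] by (simp add: move_def inner_add_left)
    then show ?thesis using that x0j by (simp add: rectangle_def)
  qed
  have \<theta>d: "\<theta> * (b j - a j) \<ge> 0" "\<theta> * (b j - a j) < b j - a j" for j
    using \<theta> less[of j] by (simp_all add: mult_less_cancel_right1)
  have "a j \<le> hi j \<and> hi j < b j \<and> a j \<le> lo j \<and> lo j < b j" for j
  proof -
    have "a j + \<theta> * (b j - a j) < b j" using \<theta>d(2)[of j] by linarith
    then show ?thesis using \<theta>d(1)[of j] less[of j] by (simp add: hi_def lo_def)
  qed
  then have "move hi \<in> rectangle f a b" "move lo \<in> rectangle f a b"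
    by (simp_all add: move_in)
  moreover have "(move hi - move lo) \<bullet> u = \<theta> * (\<Sum>j<n. \<bar>u \<bullet> f j\<bar> * (b j - a j))"
  proof -
    have "move hi - move lo = (\<Sum>j<n. (hi j - lo j) *\<^sub>R f j)"
      by (simp add: move_def sum_subtractf[symmetric] scaleR_diff_left[symmetric])
    then have "(move hi - move lo) \<bullet> u = (\<Sum>j<n. (hi j - lo j) * (f j \<bullet> u))"
      by (simp add: inner_sum_left)
    also have "\<dots> = (\<Sum>j<n. \<theta> * (\<bar>u \<bullet> f j\<bar> * (b j - a j)))"
      by (intro sum.cong) (auto simp: hi_def lo_def inner_commute abs_if)
    finally show ?thesis by (simp add: sum_distrib_left)
  qed
  ultimately show ?thesis by blast
qed

text \<open>Nearness in \<open>M\<close> coordinates controls the head of the expansion of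
  \<open>(y - z) \<bullet> u\<close>; the summable widths control its tail uniformly over the
  rectangle.\<close>

lemma fat_rectangle_localize:
  assumes f: "orthonormal_basis f" and fat: "fat_rectangle f a b" and z: "z \<in> rectangle f a b"
    and summ: "summable (\<lambda>j. \<bar>u \<bullet> f j\<bar> * (b j - a j))" and \<delta>: "\<delta> > 0"
  shows "\<exists>a' b'. fat_rectangle f a' b' \<and> rectangle f a' b' \<subseteq> rectangle f a b \<and>
    (\<forall>y\<in>rectangle f a' b'. \<bar>(y - z) \<bullet> u\<bar> < \<delta>)"
proof -
  let ?v = "\<lambda>j. \<bar>u \<bullet> f j\<bar> * (b j - a j)"
  obtain M where M: "norm (\<Sum>j. ?v (j + M)) < \<delta> / 2"
    using suminf_exist_split[OF _ summ, of "\<delta> / 2"] \<delta> by (auto simp: add.commute)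
  define K where "K = (\<Sum>j<M. \<bar>u \<bullet> f j\<bar>)"
  have K: "K \<ge> 0" by (simp add: K_def sum_nonneg)
  \<comment> \<open>The head is then at most \<open>\<eta> * K < \<delta> / 2\<close>; the added 1
    covers \<open>K = 0\<close>.\<close>
  define \<eta> where "\<eta> = \<delta> / (2 * (1 + K))"
  have \<eta>: "\<eta> > 0" using \<delta> K by (simp add: \<eta>_def)
  have \<eta>K: "\<eta> * K < \<delta> / 2"
    using \<delta> K by (simp add: \<eta>_def divide_simps mult_less_0_iff)
  define a' where "a' j = (if j < M then z \<bullet> f j else a j)" for j
  define b' where "b' j = (if j < M then min (b j) (z \<bullet> f j + \<eta>) else b j)" for j
  have zj: "a j \<le> z \<bullet> f j" "z \<bullet> f j < b j" for j using z by (auto simp: rectangle_def)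
  have z': "z \<in> rectangle f a' b'"
    using zj \<eta> by (auto simp: rectangle_def a'_def b'_def)
  have fat': "fat_rectangle f a' b'" "rectangle f a' b' \<subseteq> rectangle f a b"
    using fat_rectangle_restrict[OF fat z', of M] zj by (auto simp: a'_def b'_def)
  have "\<bar>(y - z) \<bullet> u\<bar> < \<delta>" if y: "y \<in> rectangle f a' b'" for y
  proof -
    have yj: "a' j \<le> y \<bullet> f j" "y \<bullet> f j < b' j" for j using y by (auto simp: rectangle_def)
    let ?t = "\<lambda>j. \<bar>(y - z) \<bullet> f j\<bar> * \<bar>u \<bullet> f j\<bar>"
    have near: "\<bar>(y - z) \<bullet> f j\<bar> \<le> \<eta>" if "j < M" for j
      using yj[of j] that by (auto simp: a'_def b'_def inner_diff_left)
    have "y \<in> rectangle f a b" using y fat' by auto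
    then have far: "\<bar>(y - z) \<bullet> f j\<bar> \<le> b j - a j" for j
      using zj[of j] by (auto simp: rectangle_def inner_diff_left abs_le_iff dest!: spec[of _ j])
    have t_le: "?t j \<le> ?v j" for j
      using mult_left_mono[OF far[of j], of "\<bar>u \<bullet> f j\<bar>"] by (simp add: mult.commute)
    have t_summ: "summable ?t"
      by (rule summable_comparison_test'[OF summ]) (use t_le in simp)
    have "(\<lambda>j. ((y - z) \<bullet> f j) * (f j \<bullet> u)) sums ((y - z) \<bullet> u)"
      by (rule onb_inner_sums[OF f])
    then have "\<bar>(y - z) \<bullet> u\<bar> \<le> (\<Sum>j. ?t j)"
      using summable_rabs[of "\<lambda>j. ((y - z) \<bullet> f j) * (f j \<bullet> u)"] t_summ
      by (simp add: sums_iff abs_mult inner_commute)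
    also have "\<dots> = (\<Sum>j. ?t (j + M)) + (\<Sum>j<M. ?t j)"
      by (rule suminf_split_initial_segment[OF t_summ])
    also have "(\<Sum>j<M. ?t j) \<le> \<eta> * K"
      unfolding K_def sum_distrib_left by (intro sum_mono mult_right_mono near) auto
    also have "(\<Sum>j. ?t (j + M)) \<le> (\<Sum>j. ?v (j + M))"
      by (intro suminf_le t_le summable_ignore_initial_segment t_summ summ)
    finally show ?thesis using M \<eta>K by simp
  qed
  then show ?thesis using fat' by blast
qed

text \<open>Of two points further apart than \<open>\<beta> - \<alpha>\<close> in direction
  \<open>u\<close>, one lies strictly beyond the slab; localizing near it keeps a whole fat
  rectangle off the slab.\<close>

lemma fat_rectangle_avoid_slab:
  assumes f: "orthonormal_basis f" and fat: "fat_rectangle f a b"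
    and summ: "summable (\<lambda>j. \<bar>u \<bullet> f j\<bar> * (b j - a j))"
    and wide: "(\<Sum>j. \<bar>u \<bullet> f j\<bar> * (b j - a j)) > \<beta> - \<alpha>"
  shows "\<exists>a' b'. fat_rectangle f a' b' \<and> rectangle f a' b' \<subseteq> rectangle f a b \<and>
    (\<forall>y\<in>rectangle f a' b'. \<not> (\<alpha> \<le> y \<bullet> u \<and> y \<bullet> u < \<beta>))"
proof -
  let ?v = "\<lambda>j. \<bar>u \<bullet> f j\<bar> * (b j - a j)"
  obtain x0 where x0: "x0 \<in> rectangle f a b"
    using fat by (auto simp: fat_rectangle_def measurable_rectangle_def)
  have "eventually (\<lambda>n. (\<Sum>j<n. ?v j) > \<beta> - \<alpha>) sequentially"
    using order_tendstoD(1)[OF summable_LIMSEQ[OF summ] wide] .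
  then obtain n where n: "(\<Sum>j<n. ?v j) > \<beta> - \<alpha>" by (auto simp: eventually_sequentially)
  \<comment> \<open>The strict inequality leaves room both for cutting the series at
    \<open>n\<close> and for a factor \<open>\<theta>\<close> near 1.\<close>
  have "eventually (\<lambda>\<theta>. \<theta> * (\<Sum>j<n. ?v j) > \<beta> - \<alpha>) (at_left (1::real))"
  proof (rule order_tendstoD(1)[OF _ n])
    show "((\<lambda>\<theta>. \<theta> * (\<Sum>j<n. ?v j)) \<longlongrightarrow> (\<Sum>j<n. ?v j)) (at_left 1)"
      by (auto intro!: tendsto_eq_intros)
  qed
  moreover have "eventually (\<lambda>\<theta>. \<theta> \<in> {0<..<1::real}) (at_left 1)"
    by (rule eventually_at_leftI[of 0]) auto
  ultimately have "eventually (\<lambda>\<theta>. \<theta> * (\<Sum>j<n. ?v j) > \<beta> - \<alpha> \<and> \<theta> \<in> {0<..<1}) (at_left (1::real))"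
    by eventually_elim auto
  then obtain \<theta> where \<theta>: "\<theta> * (\<Sum>j<n. ?v j) > \<beta> - \<alpha>" "0 < \<theta>" "\<theta> < 1"
    using eventually_happens'[of "at_left (1::real)"] by (auto simp: trivial_limit_at_left_real)
  obtain x y where xy: "x \<in> rectangle f a b" "y \<in> rectangle f a b" "(x - y) \<bullet> u > \<beta> - \<alpha>"
    using rectangle_spread[OF f x0, of \<theta> u n] \<theta> by fastforce
  then have "x \<bullet> u > \<beta> \<or> y \<bullet> u < \<alpha>" by (auto simp: inner_diff_left)
  then obtain z \<delta> where z: "z \<in> rectangle f a b" "\<delta> > 0" "z \<bullet> u - \<delta> \<ge> \<beta> \<or> z \<bullet> u + \<delta> \<le> \<alpha>"
  proof
    assume "x \<bullet> u > \<beta>"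
    then show thesis using that[of x "x \<bullet> u - \<beta>"] xy by simp
  next
    assume "y \<bullet> u < \<alpha>"
    then show thesis using that[of y "\<alpha> - y \<bullet> u"] xy by simp
  qed
  obtain a' b' where *: "fat_rectangle f a' b'" "rectangle f a' b' \<subseteq> rectangle f a b"
    "\<And>y. y \<in> rectangle f a' b' \<Longrightarrow> \<bar>(y - z) \<bullet> u\<bar> < \<delta>"
    using fat_rectangle_localize[OF f fat z(1) summ z(2)] by blast
  have "\<not> (\<alpha> \<le> y \<bullet> u \<and> y \<bullet> u < \<beta>)" if "y \<in> rectangle f a' b'" for y
    using *(3)[OF that] z(3) by (auto simp: inner_diff_left)
  then show ?thesis using * by blast
qed

text \<open>The coordinate along \<open>e i\<close> is bounded on finitely many rectangles, hence on
  the covered one, where the spread of this coordinate dominates the partial sums.\<close>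

lemma covered_rectangle_width_summable:
  assumes f: "orthonormal_basis f" and ne: "rectangle f a b \<noteq> {}"
    and "finite K" and cover: "rectangle f a b \<subseteq> (\<Union>p\<in>K. rectangle e (fst p) (snd p))"
  shows "summable (\<lambda>j. \<bar>e i \<bullet> f j\<bar> * (b j - a j))"
proof -
  obtain x0 where x0: "x0 \<in> rectangle f a b" using ne by auto
  define B where "B = (\<Sum>p\<in>K. \<bar>fst p i\<bar> + \<bar>snd p i\<bar>)"
  have B: "\<bar>x \<bullet> e i\<bar> \<le> B" if x: "x \<in> rectangle f a b" for x
  proof -
    obtain p where p: "p \<in> K" "x \<in> rectangle e (fst p) (snd p)" using cover x by blast
    have "\<bar>x \<bullet> e i\<bar> \<le> \<bar>fst p i\<bar> + \<bar>snd p i\<bar>"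
      using p(2) by (auto simp: rectangle_def dest!: spec[of _ i])
    also have "\<dots> \<le> B" unfolding B_def using p(1) \<open>finite K\<close> by (intro member_le_sum) auto
    finally show ?thesis .
  qed
  \<comment> \<open>Half of each partial sum is a difference of two values of modulus at most
    \<open>B\<close>.\<close>
  have "(\<Sum>j<n. \<bar>e i \<bullet> f j\<bar> * (b j - a j)) \<le> 4 * B" for n
  proof -
    obtain x y where "x \<in> rectangle f a b" "y \<in> rectangle f a b"
      "(x - y) \<bullet> e i = 1 / 2 * (\<Sum>j<n. \<bar>e i \<bullet> f j\<bar> * (b j - a j))"
      using rectangle_spread[OF f x0, of "1/2" "e i" n] by auto
    then show ?thesis using B[of x] B[of y] by (simp add: inner_diff_left abs_le_iff)
  qed
  moreover have "\<bar>e i \<bullet> f j\<bar> * (b j - a j) \<ge> 0" for j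
    using rectangle_nonempty_less[OF ne, of j] by simp
  ultimately show ?thesis by (intro summableI_nonneg_bounded)
qed

text \<open>If the covered rectangle is wider than \<open>p\<close> in some direction \<open>e i\<close>, it contains a fat rectangle that
  misses \<open>p\<close>, so \<open>p\<close> can be dropped from the covering.\<close>

lemma covered_fat_rectangle_width_le:
  assumes f: "orthonormal_basis f" and "finite K" and "fat_rectangle f a b"
    and "rectangle f a b \<subseteq> (\<Union>p\<in>K. rectangle e (fst p) (snd p))"
  shows "\<exists>p\<in>K. \<exists>a b. fat_rectangle f a b \<and> (\<forall>i. summable (\<lambda>j. \<bar>e i \<bullet> f j\<bar> * (b j - a j)) \<and>
      (\<Sum>j. \<bar>e i \<bullet> f j\<bar> * (b j - a j)) \<le> snd p i - fst p i)"
  using assms(2-)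
proof (induction K arbitrary: a b)
  case empty
  then show ?case by (auto simp: fat_rectangle_def measurable_rectangle_def)
next
  case (insert p K)
  have "rectangle f a b \<noteq> {}" using insert.prems(1) by (simp add: fat_rectangle_def measurable_rectangle_def)
  then have summ: "summable (\<lambda>j. \<bar>e i \<bullet> f j\<bar> * (b j - a j))" for i
    using insert by (intro covered_rectangle_width_summable[OF f, where K = "insert p K"]) auto
  show ?case
  proof (cases "\<forall>i. (\<Sum>j. \<bar>e i \<bullet> f j\<bar> * (b j - a j)) \<le> snd p i - fst p i")
    case True
    then show ?thesis using summ insert.prems(1) by blast
  next
    case False
    then obtain i where "(\<Sum>j. \<bar>e i \<bullet> f j\<bar> * (b j - a j)) > snd p i - fst p i" by (auto simp: not_le)
    from fat_rectangle_avoid_slab[OF f insert.prems(1) summ this]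
    obtain a' b' where *: "fat_rectangle f a' b'" "rectangle f a' b' \<subseteq> rectangle f a b"
      "\<And>y. y \<in> rectangle f a' b' \<Longrightarrow> \<not> (fst p i \<le> y \<bullet> e i \<and> y \<bullet> e i < snd p i)" by blast
    have "rectangle f a' b' \<inter> rectangle e (fst p) (snd p) = {}"
      using *(3) by (auto simp: rectangle_def)
    then have "rectangle f a' b' \<subseteq> (\<Union>p\<in>K. rectangle e (fst p) (snd p))"
      using *(2) insert.prems(2) by auto
    from insert.IH[OF *(1) this] show ?thesis by blast
  qed
qed

subsection \<open>Nearly diagonal matrices\<close>

lemma ennreal_suminf_swap:
  fixes g :: "nat \<Rightarrow> nat \<Rightarrow> ennreal"
  shows "(\<Sum>i. \<Sum>j. g i j) = (\<Sum>j. \<Sum>i. g i j)"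
  using nn_integral_suminf[of "\<lambda>i j. g i j" "count_space UNIV"]
  by (simp add: nn_integral_count_space_nat)

lemma abs_exp_minus_one_le:
  fixes y :: real
  assumes "\<bar>y\<bar> \<le> 1"
  shows "\<bar>exp y - 1\<bar> \<le> 2 * \<bar>y\<bar>"
proof (cases "y \<ge> 0")
  case True
  then have "exp y \<le> 1 + y + y\<^sup>2" using assms by (intro exp_bound) auto
  moreover have "y\<^sup>2 \<le> y" using True assms by (simp add: power2_eq_square mult_left_le)
  ultimately show ?thesis using True by simp
next
  case False
  then have "exp y < 1" "1 + y \<le> exp y" by simp_all
  then show ?thesis using False by linarith
qed

text \<open>Passes from logarithms to the numbers themselves. It is applied to twice the logarithm
  of a side, or twice its positive part, which yields squares.\<close>

lemma summable_abs_exp_minus_one: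
  fixes y :: "nat \<Rightarrow> real"
  assumes "summable (\<lambda>j. \<bar>y j\<bar>)"
  shows "summable (\<lambda>j. \<bar>exp (y j) - 1\<bar>)"
proof (rule summable_comparison_test_ev)
  show "summable (\<lambda>j. 2 * \<bar>y j\<bar>)" using assms by (rule summable_mult)
  have "eventually (\<lambda>j. \<bar>y j\<bar> < 1) sequentially"
    by (rule order_tendstoD(2)[OF summable_LIMSEQ_zero[OF assms]]) simp
  then show "eventually (\<lambda>j. norm \<bar>exp (y j) - 1\<bar> \<le> 2 * \<bar>y j\<bar>) sequentially"
    by eventually_elim (use abs_exp_minus_one_le in simp)
qed

text \<open>The distinguished entry \<open>k\<close> nearly maximises \<open>\<bar>c j\<bar> d j\<close>: it is chosen so that
  \<open>\<Sum>j. (c j d j)\<^sup>2 \<le> \<bar>c k\<bar> d k w\<close>.\<close>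

lemma unit_row_off_diagonal:
  fixes c d :: "nat \<Rightarrow> real"
  assumes c: "(\<lambda>j. (c j)\<^sup>2) sums 1" and \<delta>: "0 < \<delta>" "\<And>j. \<delta> \<le> d j"
    and summ: "summable (\<lambda>j. \<bar>c j\<bar> * d j)" "summable (\<lambda>j. (c j)\<^sup>2 * \<bar>1 - (d j)\<^sup>2\<bar>)"
  defines "w \<equiv> \<Sum>j. \<bar>c j\<bar> * d j"
  shows "\<exists>k. summable (\<lambda>j. if j = k then 0 else \<bar>c j\<bar>) \<and>
    \<delta>\<^sup>2 * (\<Sum>j. if j = k then 0 else \<bar>c j\<bar>) \<le> max 0 (w\<^sup>2 - 1) + (\<Sum>j. (c j)\<^sup>2 * \<bar>1 - (d j)\<^sup>2\<bar>)"
proof -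
  let ?v = "\<lambda>j. \<bar>c j\<bar> * d j" and ?T = "\<Sum>j. (c j)\<^sup>2 * \<bar>1 - (d j)\<^sup>2\<bar>"
  have d0: "0 < d j" for j using \<delta>(1) \<delta>(2)[of j] by linarith
  have c1: "\<bar>c j\<bar> \<le> 1" for j
  proof -
    have "(c j)\<^sup>2 \<le> 1"
      using sum_le_suminf[of "\<lambda>j. (c j)\<^sup>2" "{j}"] c by (simp add: sums_iff)
    then show ?thesis by (simp add: abs_square_le_1)
  qed
  have sq: "summable (\<lambda>j. (c j)\<^sup>2 * (1 - (d j)\<^sup>2))"
    by (rule summable_comparison_test'[OF summ(2)]) (simp add: abs_mult)
  have v2: "(\<lambda>j. (?v j)\<^sup>2) sums (1 - (\<Sum>j. (c j)\<^sup>2 * (1 - (d j)\<^sup>2)))"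
    using sums_diff[OF c summable_sums[OF sq]] by (simp add: power_mult_distrib algebra_simps)
  define s where "s = (\<Sum>j. (?v j)\<^sup>2)"
  have s_ge: "1 - s \<le> ?T"
  proof -
    have "(\<Sum>j. (c j)\<^sup>2 * (1 - (d j)\<^sup>2)) \<le> ?T"
      by (intro suminf_le sq summ mult_left_mono) auto
    then show ?thesis using v2 by (simp add: s_def sums_iff)
  qed
  \<comment> \<open>The l1 norm of a unit row is at least 1; sides bounded below by
    \<open>\<delta>\<close> then keep \<open>w\<close> away from 0, so that a bound on
    \<open>w * (\<delta> * R)\<close> bounds \<open>R\<close>.\<close>
  have w_ge: "\<delta> \<le> w"
  proof -
    have "\<delta> * (\<Sum>j. (c j)\<^sup>2) \<le> w"
      unfolding w_def suminf_mult[OF sums_summable[OF c], symmetric]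
    proof (intro suminf_le summ summable_mult sums_summable[OF c])
      fix j
      have "(c j)\<^sup>2 \<le> \<bar>c j\<bar>"
        using mult_left_mono[OF c1[of j], of "\<bar>c j\<bar>"] by (simp add: power2_eq_square)
      then show "\<delta> * (c j)\<^sup>2 \<le> \<bar>c j\<bar> * d j"
        using mult_mono[OF \<delta>(2)[of j]] \<delta>(1) d0[of j] by (subst (2) mult.commute) auto
    qed
    then show ?thesis using c by (simp add: sums_iff)
  qed
  \<comment> \<open>If every \<open>?v k * w\<close> were below \<open>s\<close>, the terms
    \<open>?v j * (s - ?v j * w)\<close> would be nonnegative and not all 0, yet their sum is
    \<open>w * s - s * w = 0\<close>.\<close>
  have "\<exists>k. s \<le> ?v k * w"
  proof (rule ccontr)
    assume "\<not> ?thesis"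
    then have lt: "?v k * w < s" for k by (simp add: not_le)
    have "(\<lambda>j. ?v j * s - (?v j)\<^sup>2 * w) sums (w * s - s * w)"
      unfolding w_def s_def using summ(1) sums_summable[OF v2]
      by (intro sums_diff sums_mult2 summable_sums)
    moreover have nonneg: "0 \<le> ?v j * s - (?v j)\<^sup>2 * w" for j
      using mult_left_mono[OF less_imp_le[OF lt[of j]], of "?v j"] d0[of j]
      by (simp add: power2_eq_square mult.assoc)
    ultimately have zero: "?v j * s - (?v j)\<^sup>2 * w = 0" for j
      using suminf_eq_zero_iff[of "\<lambda>j. ?v j * s - (?v j)\<^sup>2 * w"] by (simp add: sums_iff)
    have "\<exists>j. c j \<noteq> 0"
    proof (rule ccontr)
      assume "\<nexists>j. c j \<noteq> 0"
      then show False using c sums_unique2[OF c, of 0] by simp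
    qed
    then obtain j where "c j \<noteq> 0" by blast
    then have "?v j > 0" using d0[of j] by simp
    moreover have "?v j * (s - ?v j * w) = 0"
      using zero[of j] by (simp add: power2_eq_square algebra_simps)
    ultimately show False using lt[of j] by (metis less_irrefl mult_eq_0_iff right_minus_eq)
  qed
  then obtain k where k: "s \<le> ?v k * w" by blast
  have "(\<lambda>j. if j = k then 0 else ?v j) = (\<lambda>j. ?v j - (if j = k then ?v j else 0))"
    by auto
  then have off: "(\<lambda>j. if j = k then 0 else ?v j) sums (w - ?v k)"
    using sums_diff[OF summable_sums[OF summ(1)] sums_single[of k ?v]] by (simp only: w_def)
  have le: "\<delta> * (if j = k then 0 else \<bar>c j\<bar>) \<le> (if j = k then 0 else ?v j)" for j
    using mult_left_mono[OF \<delta>(2)[of j], of "\<bar>c j\<bar>"] by (auto simp: mult.commute)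
  have "summable (\<lambda>j. \<delta> * (if j = k then 0 else \<bar>c j\<bar>))"
    by (rule summable_comparison_test'[OF sums_summable[OF off]]) (use le \<delta> in auto)
  then have off_summ: "summable (\<lambda>j. if j = k then 0 else \<bar>c j\<bar>)"
    using \<delta>(1) by (simp add: summable_cmult_iff)
  define R where "R = (\<Sum>j. if j = k then 0 else \<bar>c j\<bar>)"
  have R0: "R \<ge> 0" unfolding R_def by (intro suminf_nonneg off_summ) auto
  have "\<delta> * R \<le> w - ?v k"
    unfolding R_def suminf_mult[OF off_summ, symmetric]
    using suminf_le[OF le summable_mult[OF off_summ] sums_summable[OF off]] off by (simp add: sums_iff)
  then have "w * (\<delta> * R) \<le> w * (w - ?v k)"
    using w_ge \<delta>(1) by (intro mult_left_mono) auto
  moreover have "\<delta> * (\<delta> * R) \<le> w * (\<delta> * R)"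
    using w_ge \<delta>(1) R0 by (intro mult_right_mono) auto
  moreover have "w * (w - ?v k) \<le> (w\<^sup>2 - 1) + (1 - s)"
    using k by (simp add: power2_eq_square algebra_simps)
  ultimately have "\<delta>\<^sup>2 * R \<le> max 0 (w\<^sup>2 - 1) + ?T"
    using s_ge by (simp add: power2_eq_square)
  then show ?thesis using off_summ unfolding R_def by blast
qed

text \<open>Both the row and the column products of \<open>\<bar>e i \<bullet> f j\<bar>\<close> are finite once the matrix is nearly
  diagonal, which makes the asymmetric hypothesis of the theorem symmetric in \<open>e\<close> and \<open>f\<close>.\<close>

definition near_diagonal :: "(nat \<Rightarrow> nat \<Rightarrow> real) \<Rightarrow> (nat \<Rightarrow> nat) \<Rightarrow> bool" where
  "near_diagonal c \<sigma> \<longleftrightarrow> (\<forall>i. summable (\<lambda>j. if j = \<sigma> i then 0 else \<bar>c i j\<bar>)) \<and>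
     summable (\<lambda>i. \<Sum>j. if j = \<sigma> i then 0 else \<bar>c i j\<bar>)"

lemma summable_suminf_swap:
  fixes g :: "nat \<Rightarrow> nat \<Rightarrow> real"
  assumes nonneg: "\<And>i j. g i j \<ge> 0" and rows: "\<And>i. summable (g i)"
    and cols: "\<And>j. (\<lambda>i. g i j) sums h j" and "summable h"
  shows "summable (\<lambda>i. \<Sum>j. g i j)"
proof -
  have h0: "h j \<ge> 0" for j
    using suminf_nonneg[of "\<lambda>i. g i j"] cols[of j] nonneg by (simp add: sums_iff)
  have "(\<Sum>i. ennreal (\<Sum>j. g i j)) = (\<Sum>i. \<Sum>j. ennreal (g i j))"
    by (intro suminf_cong suminf_ennreal2[symmetric] nonneg rows)
  also have "\<dots> = (\<Sum>j. \<Sum>i. ennreal (g i j))" by (rule ennreal_suminf_swap)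
  also have "\<dots> = (\<Sum>j. ennreal (h j))"
    by (intro suminf_cong) (use cols nonneg in \<open>simp add: suminf_ennreal2 sums_iff\<close>)
  also have "\<dots> = ennreal (\<Sum>j. h j)" by (intro suminf_ennreal2 h0 assms)
  finally have "(\<Sum>i. ennreal (\<Sum>j. g i j)) \<noteq> top" by simp
  then show ?thesis
    by (rule summable_suminf_not_top[rotated]) (intro suminf_nonneg rows nonneg)
qed

text \<open>Both error terms of the row estimate are summable over \<open>i\<close>: the excess
  width through the positive logarithms of the sides of the \<open>e\<close>-rectangle, the other
  one because every column of \<open>e i \<bullet> f j\<close> has norm one.\<close>

lemma near_diagonal_if_widths:
  assumes e: "orthonormal_basis e" and f: "orthonormal_basis f"
    and fat: "fat_rectangle f a b" and mr: "measurable_rectangle e \<alpha> \<beta>"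
    and summ: "\<And>i. summable (\<lambda>j. \<bar>e i \<bullet> f j\<bar> * (b j - a j))"
    and width: "\<And>i. (\<Sum>j. \<bar>e i \<bullet> f j\<bar> * (b j - a j)) \<le> \<beta> i - \<alpha> i"
  shows "\<exists>\<sigma>. near_diagonal (\<lambda>i j. e i \<bullet> f j) \<sigma>"
proof -
  let ?d = "\<lambda>j. b j - a j" and ?c = "\<lambda>i j. e i \<bullet> f j"
  define w where "w i = (\<Sum>j. \<bar>?c i j\<bar> * ?d j)" for i
  have mab: "measurable_rectangle f a b" using fat by (simp add: fat_rectangle_def)
  have d0: "?d j > 0" for j using measurable_rectangle_less[OF mab, of j] by simp
  have ln: "summable (\<lambda>j. \<bar>ln (?d j)\<bar>)"
  proof -
    have "summable (\<lambda>j. 2 * max 0 (ln (?d j)) - ln (?d j))"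
      using fat by (intro summable_diff summable_mult) (auto simp: fat_rectangle_def measurable_rectangle_def)
    moreover have "2 * max 0 (ln (?d j)) - ln (?d j) = \<bar>ln (?d j)\<bar>" for j by auto
    ultimately show ?thesis by simp
  qed
  \<comment> \<open>A lower bound common to all sides, since each is at least the exponential of
    minus the modulus of its logarithm.\<close>
  define \<delta> where "\<delta> = exp (- (\<Sum>j. \<bar>ln (?d j)\<bar>))"
  have \<delta>: "\<delta> > 0" by (simp add: \<delta>_def)
  have \<delta>_le: "\<delta> \<le> ?d j" for j
  proof -
    have "\<bar>ln (?d j)\<bar> \<le> (\<Sum>j. \<bar>ln (?d j)\<bar>)"
      using sum_le_suminf[OF ln, of "{j}"] by simp
    then have "\<delta> \<le> exp (ln (?d j))" unfolding \<delta>_def by simp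
    then show ?thesis using d0[of j] by simp
  qed
  have "summable (\<lambda>j. \<bar>2 * ln (?d j)\<bar>)"
    using summable_mult[OF ln, of 2] by (simp add: abs_mult)
  from summable_abs_exp_minus_one[OF this]
  have dsq: "summable (\<lambda>j. \<bar>1 - (?d j)\<^sup>2\<bar>)"
    using d0 by (simp add: exp_double abs_minus_commute)
  have csq: "(\<lambda>j. (?c i j)\<^sup>2) sums 1" "(\<lambda>i. (?c i j)\<^sup>2) sums 1" for i j
    using onb_parseval[OF f, of "e i"] onb_parseval[OF e, of "f j"] e f
    by (simp_all add: inner_commute)
  have "(?c i j)\<^sup>2 \<le> 1" for i j
    using sum_le_suminf[of "\<lambda>j. (?c i j)\<^sup>2" "{j}"] csq(1)[of i] by (simp add: sums_iff)
  then have rows: "summable (\<lambda>j. (?c i j)\<^sup>2 * \<bar>1 - (?d j)\<^sup>2\<bar>)" for i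
    by (intro summable_comparison_test'[OF dsq]) (simp add: mult_left_le_one_le)
  have T: "summable (\<lambda>i. \<Sum>j. (?c i j)\<^sup>2 * \<bar>1 - (?d j)\<^sup>2\<bar>)"
    using summable_suminf_swap[of "\<lambda>i j. (?c i j)\<^sup>2 * \<bar>1 - (?d j)\<^sup>2\<bar>" "\<lambda>j. 1 * \<bar>1 - (?d j)\<^sup>2\<bar>"]
      rows dsq sums_mult2[OF csq(2)] by simp
  have W: "summable (\<lambda>i. max 0 ((w i)\<^sup>2 - 1))"
  proof (rule summable_comparison_test')
    have "summable (\<lambda>i. \<bar>2 * max 0 (ln (\<beta> i - \<alpha> i))\<bar>)"
      using mr by (simp add: measurable_rectangle_def summable_mult abs_mult)
    then show "summable (\<lambda>i. \<bar>exp (2 * max 0 (ln (\<beta> i - \<alpha> i))) - 1\<bar>)"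
      by (rule summable_abs_exp_minus_one)
    fix i :: nat
    have "0 \<le> w i" unfolding w_def
      by (intro suminf_nonneg summ mult_nonneg_nonneg abs_ge_zero less_imp_le[OF d0])
    moreover have "w i \<le> exp (max 0 (ln (\<beta> i - \<alpha> i)))"
    proof -
      have "w i \<le> exp (ln (\<beta> i - \<alpha> i))"
        using width[of i] measurable_rectangle_less[OF mr, of i] by (simp add: w_def)
      also have "\<dots> \<le> exp (max 0 (ln (\<beta> i - \<alpha> i)))" by simp
      finally show ?thesis .
    qed
    ultimately have "(w i)\<^sup>2 \<le> exp (2 * max 0 (ln (\<beta> i - \<alpha> i)))"
      by (simp add: exp_double power_mono)
    moreover have "1 \<le> exp (2 * max 0 (ln (\<beta> i - \<alpha> i)))" by simp
    ultimately show "norm (max 0 ((w i)\<^sup>2 - 1)) \<le> \<bar>exp (2 * max 0 (ln (\<beta> i - \<alpha> i))) - 1\<bar>"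
      by auto
  qed
  have "\<forall>i. \<exists>k. summable (\<lambda>j. if j = k then 0 else \<bar>?c i j\<bar>) \<and>
      \<delta>\<^sup>2 * (\<Sum>j. if j = k then 0 else \<bar>?c i j\<bar>)
      \<le> max 0 ((w i)\<^sup>2 - 1) + (\<Sum>j. (?c i j)\<^sup>2 * \<bar>1 - (?d j)\<^sup>2\<bar>)"
    unfolding w_def using unit_row_off_diagonal[OF csq(1) \<delta> \<delta>_le summ rows] by blast
  from choice[OF this] obtain \<sigma> where "\<forall>i. summable (\<lambda>j. if j = \<sigma> i then 0 else \<bar>?c i j\<bar>) \<and>
      \<delta>\<^sup>2 * (\<Sum>j. if j = \<sigma> i then 0 else \<bar>?c i j\<bar>)
      \<le> max 0 ((w i)\<^sup>2 - 1) + (\<Sum>j. (?c i j)\<^sup>2 * \<bar>1 - (?d j)\<^sup>2\<bar>)" ..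
  then have \<sigma>: "summable (\<lambda>j. if j = \<sigma> i then 0 else \<bar>?c i j\<bar>)"
    "\<delta>\<^sup>2 * (\<Sum>j. if j = \<sigma> i then 0 else \<bar>?c i j\<bar>)
      \<le> max 0 ((w i)\<^sup>2 - 1) + (\<Sum>j. (?c i j)\<^sup>2 * \<bar>1 - (?d j)\<^sup>2\<bar>)" for i
    by blast+
  have "0 \<le> (\<Sum>j. if j = \<sigma> i then 0 else \<bar>?c i j\<bar>)" for i
    by (intro suminf_nonneg \<sigma>(1)) auto
  then have "summable (\<lambda>i. \<delta>\<^sup>2 * (\<Sum>j. if j = \<sigma> i then 0 else \<bar>?c i j\<bar>))"
    by (intro summable_comparison_test'[OF summable_add[OF W T]]) (use \<sigma>(2) in \<open>simp add: abs_mult\<close>)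
  then have "summable (\<lambda>i. \<Sum>j. if j = \<sigma> i then 0 else \<bar>?c i j\<bar>)"
    using \<delta> by (simp add: summable_cmult_iff)
  then show ?thesis using \<sigma>(1) unfolding near_diagonal_def by blast
qed

section \<open>Infinite products of row sums and column sums\<close>

lemma prodinf_ennreal_finite:
  fixes g x :: "nat \<Rightarrow> ennreal"
  assumes ge: "\<And>j. 1 \<le> g j" and le: "\<And>j. g j \<le> 1 + x j" and "(\<Sum>j. x j) < \<infinity>"
  shows "(\<Prod>j. g j) < \<infinity>"
proof -
  let ?P = "\<lambda>n. \<Prod>j\<le>n. g j"
  have "?P n * 1 \<le> ?P n * g (Suc n)" for n by (intro mult_left_mono ge) simp
  then have "incseq ?P" by (intro incseq_SucI) simp
  then have lim: "?P \<longlonglongrightarrow> (SUP n. ?P n)" by (rule LIMSEQ_SUP)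
  have P1: "1 \<le> ?P n" for n
    using prod_mono_ennreal[of "{..n}" "\<lambda>_. 1" g] ge by simp
  then have "1 \<le> (SUP n. ?P n)" by (meson SUP_upper2 UNIV_I)
  then have raw: "raw_has_prod g 0 (SUP n. ?P n)"
    using lim by (auto simp: raw_has_prod_def)
  \<comment> \<open>\<open>prodinf\<close> is a definite description, so the supremum must be the
    only possible value; factors of at least 1 exclude the variant of \<open>has_prod\<close> with
    vanishing factors.\<close>
  have "(\<Prod>j. g j) = (SUP n. ?P n)"
    unfolding prodinf_def
  proof (rule the_equality)
    show "g has_prod (SUP n. ?P n)" using raw by (simp add: has_prod_def)
    fix p assume "g has_prod p"
    moreover have "g j \<noteq> 0" for j using ge[of j] by auto
    ultimately have "?P \<longlonglongrightarrow> p" by (auto simp: has_prod_def raw_has_prod_def)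
    then show "p = (SUP n. ?P n)" using lim by (rule LIMSEQ_unique)
  qed
  \<comment> \<open>By \<open>1 + t \<le> exp t\<close>, factor by factor.\<close>
  moreover have "?P n \<le> ennreal (exp (enn2real (\<Sum>j. x j)))" for n
  proof -
    have "x j \<le> (\<Sum>j. x j)" for j
      using sum_le_suminf[of x "{j}"] by simp
    then have fin: "x j < top" for j using assms(3) by (metis infinity_ennreal_def le_less_trans)
    have "?P n \<le> (\<Prod>j\<le>n. 1 + x j)" by (intro prod_mono_ennreal le)
    also have "\<dots> = (\<Prod>j\<le>n. ennreal (1 + enn2real (x j)))"
      using fin by (intro prod.cong) (auto simp: ennreal_plus)
    also have "\<dots> = ennreal (\<Prod>j\<le>n. 1 + enn2real (x j))"
      by (intro prod_ennreal) simp
    also have "\<dots> \<le> ennreal (exp (\<Sum>j\<le>n. enn2real (x j)))"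
      by (intro ennreal_leI) (auto simp: exp_sum intro!: prod_mono)
    also have "(\<Sum>j\<le>n. enn2real (x j)) = enn2real (\<Sum>j\<le>n. x j)"
      using fin by (subst enn2real_sum) auto
    also have "\<dots> \<le> enn2real (\<Sum>j. x j)"
      using assms(3) by (intro enn2real_mono sum_le_suminf) auto
    finally show ?thesis by (simp add: ennreal_leI)
  qed
  then have "(SUP n. ?P n) \<le> ennreal (exp (enn2real (\<Sum>j. x j)))" by (rule SUP_least)
  ultimately show ?thesis by (metis ennreal_less_top infinity_ennreal_def le_less_trans)
qed

lemma near_diagonal_finite:
  assumes "near_diagonal c \<sigma>"
  shows "(\<Sum>i. \<Sum>j. ennreal (if j = \<sigma> i then 0 else \<bar>c i j\<bar>)) < \<infinity>"
proof -
  have "(\<Sum>j. ennreal (if j = \<sigma> i then 0 else \<bar>c i j\<bar>)) = ennreal (\<Sum>j. if j = \<sigma> i then 0 else \<bar>c i j\<bar>)" for i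
    using assms by (intro suminf_ennreal2) (auto simp: near_diagonal_def)
  moreover have "(\<Sum>i. ennreal (\<Sum>j. if j = \<sigma> i then 0 else \<bar>c i j\<bar>))
      = ennreal (\<Sum>i. \<Sum>j. if j = \<sigma> i then 0 else \<bar>c i j\<bar>)"
    using assms by (intro suminf_ennreal2 suminf_nonneg) (auto simp: near_diagonal_def)
  ultimately show ?thesis by simp
qed

lemma suminf_ennreal_single: "(\<Sum>i. if i = k then y else 0 :: ennreal) = y"
  using sums_single[of k "\<lambda>_. y"] by (simp add: sums_iff)

context
  fixes e f :: "nat \<Rightarrow> 'a::real_inner"
  assumes e: "orthonormal_basis e" and f: "orthonormal_basis f"
begin

lemma onb_inner_sq_sums:
  "(\<lambda>j. (e i \<bullet> f j)\<^sup>2) sums 1" "(\<lambda>i. (e i \<bullet> f j)\<^sup>2) sums 1"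
  using onb_parseval[OF f, of "e i"] onb_parseval[OF e, of "f j"] e f
  by (simp_all add: inner_commute)

lemma onb_inner_le_1: "\<bar>e i \<bullet> f j\<bar> \<le> 1"
  using Cauchy_Schwarz_ineq2[of "e i" "f j"] e f by simp

text \<open>Entries have modulus at most 1, so they dominate their squares, which sum to 1 along
  rows and columns.\<close>

lemma sum_abs_inner_ge_1:
  "1 \<le> (\<Sum>j. ennreal \<bar>e i \<bullet> f j\<bar>)" "1 \<le> (\<Sum>i. ennreal \<bar>e i \<bullet> f j\<bar>)"
proof -
  have sq: "(e i \<bullet> f j)\<^sup>2 \<le> \<bar>e i \<bullet> f j\<bar>" for i j
    using mult_left_mono[OF onb_inner_le_1[of i j], of "\<bar>e i \<bullet> f j\<bar>"] by (simp add: power2_eq_square)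
  have "1 = (\<Sum>j. ennreal ((e i \<bullet> f j)\<^sup>2))" "1 = (\<Sum>i. ennreal ((e i \<bullet> f j)\<^sup>2))"
    using onb_inner_sq_sums[of i] onb_inner_sq_sums(2)[of j] by (simp_all add: suminf_ennreal2 sums_iff)
  moreover have "(\<Sum>j. ennreal ((e i \<bullet> f j)\<^sup>2)) \<le> (\<Sum>j. ennreal \<bar>e i \<bullet> f j\<bar>)"
    "(\<Sum>i. ennreal ((e i \<bullet> f j)\<^sup>2)) \<le> (\<Sum>i. ennreal \<bar>e i \<bullet> f j\<bar>)"
    by (intro suminf_le ennreal_leI sq summableI)+
  ultimately show "1 \<le> (\<Sum>j. ennreal \<bar>e i \<bullet> f j\<bar>)" "1 \<le> (\<Sum>i. ennreal \<bar>e i \<bullet> f j\<bar>)" by simp_all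
qed

text \<open>The distinguished entry of a row contributes at most 1 to its sum.\<close>

lemma near_diagonal_row_prod:
  assumes "near_diagonal (\<lambda>i j. e i \<bullet> f j) \<sigma>"
  shows "(\<Prod>i. \<Sum>j. ennreal \<bar>e i \<bullet> f j\<bar>) < \<infinity>"
proof (rule prodinf_ennreal_finite[OF sum_abs_inner_ge_1(1) _ near_diagonal_finite[OF assms]])
  fix i
  have "(\<Sum>j. ennreal \<bar>e i \<bullet> f j\<bar>)
      \<le> (\<Sum>j. (if j = \<sigma> i then 1 else 0) + ennreal (if j = \<sigma> i then 0 else \<bar>e i \<bullet> f j\<bar>))"
    by (intro suminf_le summableI) (auto simp: onb_inner_le_1)
  also have "\<dots> = 1 + (\<Sum>j. ennreal (if j = \<sigma> i then 0 else \<bar>e i \<bullet> f j\<bar>))"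
    by (subst suminf_add[symmetric]) (auto simp: suminf_ennreal_single)
  finally show "(\<Sum>j. ennreal \<bar>e i \<bullet> f j\<bar>) \<le> 1 + (\<Sum>j. ennreal (if j = \<sigma> i then 0 else \<bar>e i \<bullet> f j\<bar>))" .
qed

text \<open>The diagonal entries of two rows with the same distinguished column would both exceed
  \<open>1/2\<close> in square.\<close>

lemma near_diagonal_eventually_inj:
  assumes "near_diagonal (\<lambda>i j. e i \<bullet> f j) \<sigma>"
  shows "\<exists>N. inj_on \<sigma> {N..}"
proof -
  let ?r = "\<lambda>i j. if j = \<sigma> i then 0 else \<bar>e i \<bullet> f j\<bar>"
  have r: "summable (?r i)" "summable (\<lambda>i. \<Sum>j. ?r i j)" for i
    using assms by (auto simp: near_diagonal_def)
  have "eventually (\<lambda>i. (\<Sum>j. ?r i j) < 1 / 2) sequentially"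
    by (rule order_tendstoD(2)[OF summable_LIMSEQ_zero[OF r(2)]]) simp
  then obtain N where N: "\<And>i. i \<ge> N \<Longrightarrow> (\<Sum>j. ?r i j) < 1 / 2" by (auto simp: eventually_sequentially)
  have diag: "(e i \<bullet> f (\<sigma> i))\<^sup>2 > 1 / 2" if "i \<ge> N" for i
  proof -
    have "(\<lambda>j. (e i \<bullet> f j)\<^sup>2 - (if j = \<sigma> i then (e i \<bullet> f j)\<^sup>2 else 0)) sums (1 - (e i \<bullet> f (\<sigma> i))\<^sup>2)"
      by (intro sums_diff onb_inner_sq_sums sums_single)
    moreover have "(\<Sum>j. (e i \<bullet> f j)\<^sup>2 - (if j = \<sigma> i then (e i \<bullet> f j)\<^sup>2 else 0)) \<le> (\<Sum>j. ?r i j)"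
    proof (intro suminf_le r sums_summable[OF calculation])
      fix j
      show "(e i \<bullet> f j)\<^sup>2 - (if j = \<sigma> i then (e i \<bullet> f j)\<^sup>2 else 0) \<le> ?r i j"
        using mult_left_mono[OF onb_inner_le_1[of i j], of "\<bar>e i \<bullet> f j\<bar>"] by (simp add: power2_eq_square)
    qed
    ultimately show ?thesis using N[OF that] by (simp add: sums_iff)
  qed
  have "i = k" if "i \<ge> N" "k \<ge> N" "\<sigma> i = \<sigma> k" for i k
  proof (rule ccontr)
    assume "i \<noteq> k"
    have "(\<Sum>l\<in>{i, k}. (e l \<bullet> f (\<sigma> k))\<^sup>2) \<le> 1"
      using sum_le_suminf[of "\<lambda>l. (e l \<bullet> f (\<sigma> k))\<^sup>2" "{i, k}"] onb_inner_sq_sums(2)[of "\<sigma> k"]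
      by (simp add: sums_iff)
    then show False using \<open>i \<noteq> k\<close> diag[OF that(1)] diag[OF that(2)] that(3) by simp
  qed
  then show ?thesis by (auto simp: inj_on_def intro!: exI[of _ N])
qed

text \<open>From row \<open>N\<close> on, a column holds at most one distinguished entry, which
  accounts for the leading 1. Those of the first \<open>N\<close> rows add only \<open>N\<close> to
  the total over all columns.\<close>

lemma near_diagonal_column_prod:
  assumes nd: "near_diagonal (\<lambda>i j. e i \<bullet> f j) \<sigma>"
  shows "(\<Prod>j. \<Sum>i. ennreal \<bar>e i \<bullet> f j\<bar>) < \<infinity>"
proof -
  obtain N where N: "inj_on \<sigma> {N..}" using near_diagonal_eventually_inj[OF nd] by blast
  let ?r = "\<lambda>i j. ennreal (if j = \<sigma> i then 0 else \<bar>e i \<bullet> f j\<bar>)"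
  let ?x = "\<lambda>j. (\<Sum>i. ?r i j) + (\<Sum>i<N. if j = \<sigma> i then 1 else 0)"
  show ?thesis
  proof (rule prodinf_ennreal_finite[OF sum_abs_inner_ge_1(2)])
    fix j
    define q :: "nat \<Rightarrow> ennreal" where "q i = (if i \<in> {N..} \<and> j = \<sigma> i then 1 else 0)" for i
    have q: "(\<Sum>i. q i) \<le> 1"
    proof (cases "\<exists>k\<in>{N..}. j = \<sigma> k")
      case True
      then obtain k where k: "k \<in> {N..}" "j = \<sigma> k" by blast
      then have "q = (\<lambda>i. if i = k then 1 else 0)"
        using N by (auto simp: q_def inj_on_def fun_eq_iff)
      then show ?thesis by (simp add: suminf_ennreal_single)
    next
      case False
      then have "q = (\<lambda>_. 0)" by (auto simp: q_def fun_eq_iff)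
      then show ?thesis by simp
    qed
    have "(\<Sum>i. ennreal \<bar>e i \<bullet> f j\<bar>) \<le> (\<Sum>i. ?r i j + ((if i < N \<and> j = \<sigma> i then 1 else 0) + q i))"
      by (intro suminf_le summableI) (auto simp: onb_inner_le_1 q_def)
    also have "\<dots> = (\<Sum>i. ?r i j) + ((\<Sum>i. if i < N \<and> j = \<sigma> i then 1 else 0) + (\<Sum>i. q i))"
      by (simp add: suminf_add[symmetric])
    also have "(\<Sum>i. if i < N \<and> j = \<sigma> i then 1 else 0 :: ennreal) = (\<Sum>i<N. if j = \<sigma> i then 1 else 0)"
      by (subst suminf_finite[of "{..<N}"]) (auto intro!: sum.cong)
    also have "(\<Sum>i. ?r i j) + ((\<Sum>i<N. if j = \<sigma> i then 1 else 0) + (\<Sum>i. q i))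
        \<le> (\<Sum>i. ?r i j) + ((\<Sum>i<N. if j = \<sigma> i then 1 else 0) + 1)"
      using q by (intro add_left_mono)
    finally show "(\<Sum>i. ennreal \<bar>e i \<bullet> f j\<bar>) \<le> 1 + ?x j" by (simp add: ac_simps)
  next
    have "(\<Sum>j. ?x j) = (\<Sum>j. \<Sum>i. ?r i j) + (\<Sum>j. \<Sum>i<N. if j = \<sigma> i then 1 else 0)"
      by (rule suminf_add[symmetric]) auto
    also have "(\<Sum>j. \<Sum>i<N. if j = \<sigma> i then 1 else 0 :: ennreal) = (\<Sum>i<N. \<Sum>j. if j = \<sigma> i then 1 else 0)"
      by (rule suminf_sum) simp
    also have "\<dots> = of_nat N" by (simp add: suminf_ennreal_single)
    also have "(\<Sum>j. \<Sum>i. ?r i j) = (\<Sum>i. \<Sum>j. ?r i j)" by (rule ennreal_suminf_swap)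
    finally show "(\<Sum>j. ?x j) < \<infinity>"
      using near_diagonal_finite[OF nd] by (simp add: ennreal_of_nat_eq_real_of_nat)
  qed
qed

end

subsection \<open>Sets measurable with respect to two bases\<close>

text \<open>Without a fat rectangle inside \<open>A\<close> every inner approximation is null, so
  the matching outer ones have arbitrarily small measure.\<close>

lemma completed_measure_nonzero_fat:
  fixes f :: "nat \<Rightarrow> 'a::{real_inner, complete_space}"
  assumes f: "orthonormal_basis f" and A: "A \<in> completed_ring f" and nz: "completed_measure f A \<noteq> 0"
  shows "\<exists>a b. fat_rectangle f a b \<and> rectangle f a b \<subseteq> A"
proof (rule ccontr)
  assume thin: "\<not> ?thesis"
  let ?S = "rect_measure f ` {U \<in> rect_ring f. A \<subseteq> U}"
  note \<mu> = is_rect_measure_rect_measure[OF f]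
  have lower: "0 \<le> y" if "y \<in> ?S" for y using that rect_measure_nonneg[OF \<mu>] by auto
  then have bdd: "bdd_below ?S" by (rule bdd_belowI)
  have small: "\<exists>y\<in>?S. y < \<epsilon>" if \<epsilon>: "\<epsilon> > 0" for \<epsilon>
  proof -
    obtain L U where LU: "L \<in> rect_ring f" "U \<in> rect_ring f" "L \<subseteq> A" "A \<subseteq> U"
      "rect_measure f (U - L) < \<epsilon>" using A \<epsilon> unfolding completed_ring_def by blast
    have "rect_measure f L = 0"
    proof (rule ccontr)
      assume "rect_measure f L \<noteq> 0"
      then have "rect_measure f L > 0" using rect_measure_nonneg[OF \<mu> LU(1)] by simp
      from rect_measure_pos_imp_fat[OF \<mu> LU(1) this] show False using thin LU(3) by blast
    qed
    then have "rect_measure f U < \<epsilon>"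
      using rect_measure_Diff[OF \<mu> LU(2,1)] LU by simp
    then show ?thesis using LU by blast
  qed
  have "?S \<noteq> {}" using small[of 1] by auto
  then have "0 \<le> Inf ?S" using lower by (intro cInf_greatest)
  moreover have "Inf ?S \<le> 0"
  proof (rule field_le_epsilon)
    fix \<epsilon> :: real assume "\<epsilon> > 0"
    then obtain y where "y \<in> ?S" "y < \<epsilon>" using small by blast
    then show "Inf ?S \<le> 0 + \<epsilon>" using cInf_lower[OF _ bdd, of y] by simp
  qed
  ultimately show False using nz by (simp add: completed_measure_def)
qed

lemma completed_ring_covered:
  assumes "A \<in> completed_ring e"
  shows "\<exists>K. finite K \<and> (\<forall>p\<in>K. measurable_rectangle e (fst p) (snd p)) \<and>
    A \<subseteq> (\<Union>p\<in>K. rectangle e (fst p) (snd p))"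
proof -
  obtain U where U: "U \<in> rect_ring e" "A \<subseteq> U"
    using assms zero_less_one unfolding completed_ring_def by blast
  from rect_ring_covered[OF U(1)] obtain X where X: "finite X" "X \<subseteq> rectangles e" "U \<subseteq> \<Union>X"
    by auto
  have "\<exists>p. measurable_rectangle e (fst p) (snd p) \<and> R = rectangle e (fst p) (snd p)"
    if R: "R \<in> X - {{}}" for R
  proof -
    obtain a b where "measurable_rectangle e a b" "R = rectangle e a b"
      using X(2) R unfolding rectangles_def by blast
    then show ?thesis by (intro exI[of _ "(a, b)"]) simp
  qed
  then obtain p where p: "\<And>R. R \<in> X - {{}} \<Longrightarrow> measurable_rectangle e (fst (p R)) (snd (p R))"
    "\<And>R. R \<in> X - {{}} \<Longrightarrow> R = rectangle e (fst (p R)) (snd (p R))" by metis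
  have "A \<subseteq> (\<Union>q\<in>p ` (X - {{}}). rectangle e (fst q) (snd q))"
  proof
    fix x assume "x \<in> A"
    then obtain R where "R \<in> X - {{}}" "x \<in> R" using X(3) U(2) by blast
    then show "x \<in> (\<Union>q\<in>p ` (X - {{}}). rectangle e (fst q) (snd q))" using p(2) by blast
  qed
  then show ?thesis using X(1) p(1) by (intro exI[of _ "p ` (X - {{}})"]) auto
qed

lemma near_diagonal_if_completed_measure_nonzero:
  fixes e f :: "nat \<Rightarrow> 'a::{real_inner, complete_space}"
  assumes e: "orthonormal_basis e" and f: "orthonormal_basis f"
    and A: "A \<in> completed_ring e" "A \<in> completed_ring f" and nz: "completed_measure f A \<noteq> 0"
  shows "\<exists>\<sigma>. near_diagonal (\<lambda>i j. e i \<bullet> f j) \<sigma>"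
proof -
  obtain a b where ab: "fat_rectangle f a b" "rectangle f a b \<subseteq> A"
    using completed_measure_nonzero_fat[OF f A(2) nz] by blast
  obtain K where K: "finite K" "\<And>p. p \<in> K \<Longrightarrow> measurable_rectangle e (fst p) (snd p)"
    "A \<subseteq> (\<Union>p\<in>K. rectangle e (fst p) (snd p))"
    using completed_ring_covered[OF A(1)] by blast
  have "rectangle f a b \<subseteq> (\<Union>p\<in>K. rectangle e (fst p) (snd p))" using ab(2) K(3) by blast
  from covered_fat_rectangle_width_le[OF f K(1) ab(1) this] K(2)
  obtain p a' b' where "measurable_rectangle e (fst p) (snd p)" "fat_rectangle f a' b'"
    "\<And>i. summable (\<lambda>j. \<bar>e i \<bullet> f j\<bar> * (b' j - a' j))"
    "\<And>i. (\<Sum>j. \<bar>e i \<bullet> f j\<bar> * (b' j - a' j)) \<le> snd p i - fst p i" by blast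
  then show ?thesis by (intro near_diagonal_if_widths[OF e f])
qed

theorem theorem5p1:
  fixes e f :: "nat \<Rightarrow> 'a::{real_inner, polish_space}"
  assumes "\<nexists>B :: 'a set. finite B \<and> span B = UNIV"
    and "orthonormal_basis e"
    and "orthonormal_basis f"
    and "\<not> (\<Prod>j. \<Sum>i. ennreal \<bar>e i \<bullet> f j\<bar>) < \<infinity>"
    and "A \<in> completed_ring e \<inter> completed_ring f"
  shows "completed_measure f A = 0 \<and> completed_measure e A = 0"
proof (rule ccontr)
  assume "\<not> ?thesis"
  then consider "completed_measure f A \<noteq> 0" | "completed_measure e A \<noteq> 0" by blast
  then have "(\<Prod>j. \<Sum>i. ennreal \<bar>e i \<bullet> f j\<bar>) < \<infinity>"
  proof cases
    \<comment> \<open>The rows of the nearly diagonal matrix belong to \<open>e\<close>, so the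
      product in question runs over its columns.\<close>
    case 1
    then show ?thesis
      using near_diagonal_if_completed_measure_nonzero[of e f A] near_diagonal_column_prod assms(2,3,5)
      by blast
  next
    \<comment> \<open>With the bases exchanged the matrix is transposed, and the same product runs
      over its rows.\<close>
    case 2
    then obtain \<sigma> where "near_diagonal (\<lambda>j i. f j \<bullet> e i) \<sigma>"
      using near_diagonal_if_completed_measure_nonzero[of f e A] assms(2,3,5) by blast
    from near_diagonal_row_prod[OF assms(3,2) this] show ?thesis
      by (simp add: inner_commute)
  qed
  with assms(4) show False by contradiction
qed

end
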